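(* Let $G$ be a finite group all of whose irreducible complex characters are real-valued and let $\varepsilon:G\to\{\pm1\}$ be a non-trivial group morphism. Then $$\#\{\rho\in Irr(G)\mid \rho^T=\rho\}=\sum_{c\in C(G)}\varepsilon(c).$$ In particular, the number of symmetric Young diagrams of size $d$ is given by $$\sum_{|\lambda|=d}\varepsilon(c_\lambda),$$ where the sum is over the integer partitions $\lambda$ of $d$.
   Context: $Irr(G)$ is the set of isomorphism classes of irreducible complex representations of $G$ and $C(G)$ the set of conjugacy classes of $G$. $\rho^T=\rho\otimes\varepsilon$, with $\varepsilon$ viewed as a one-dimensional representation, and $\rho^T=\rho$ means isomorphic. $\varepsilon(c)$ is the common value of $\varepsilon$ on $c$. For a partition $\lambda$ of $d$, $c_\lambda\subset\mathfrak{S}_d$ is the conjugacy class of permutations of cycle type $\lambda$ and $\varepsilon(c_\lambda)$ is their sign. A Young diagram is symmetric if it equals its reflection across the diagonal. *)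

theory Defs
  imports
    "HOL-Algebra.Group_Action"
    "HOL-Algebra.Sym_Groups"
    "HOL-Combinatorics.Orbits"
    "Jordan_Normal_Form.VS_Connect"
begin

section \<open>Complex representations\<close>

text \<open>
  A finite-dimensional complex representation is a pair \<open>(n, \<rho>)\<close> with \<open>\<rho>\<close> a homomorphism into
  \<open>GL\<^sub>n(\<complex>)\<close>. Up to isomorphism this covers all irreducible representations of a finite group,
  which are automatically finite-dimensional. The values of \<open>\<rho>\<close> outside the carrier of the group
  are arbitrary; they do not affect isomorphism classes.
\<close>

type_synonym 'a rep = "nat \<times> ('a \<Rightarrow> complex mat)"

definition GL :: "nat \<Rightarrow> complex mat monoid" where
  "GL n = units_of (ring_mat TYPE(complex) n ())"

definition reps :: "('a, 'b) monoid_scheme \<Rightarrow> 'a rep set" where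
  "reps G = {(n, \<rho>). \<rho> \<in> hom G (GL n)}"

definition rep_iso :: "('a, 'b) monoid_scheme \<Rightarrow> ('a rep \<times> 'a rep) set" where
  "rep_iso G = {((n, \<rho>), (m, \<sigma>)). (n, \<rho>) \<in> reps G \<and> (m, \<sigma>) \<in> reps G \<and>
     (\<exists>P \<in> carrier_mat m n. invertible_mat P \<and> (\<forall>g \<in> carrier G. P * \<rho> g = \<sigma> g * P))}"

definition irreps :: "('a, 'b) monoid_scheme \<Rightarrow> 'a rep set" where
  "irreps G = {(n, \<rho>) \<in> reps G. n > 0 \<and>
     (\<forall>W. VectorSpace.subspace class_ring W (module_vec TYPE(complex) n) \<and>
          (\<forall>g \<in> carrier G. \<forall>w \<in> W. \<rho> g *\<^sub>v w \<in> W)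
        \<longrightarrow> W = {0\<^sub>v n} \<or> W = carrier_vec n)}"

definition Irr :: "('a, 'b) monoid_scheme \<Rightarrow> 'a rep set set" where
  "Irr G = irreps G // rep_iso G"

definition mat_trace :: "complex mat \<Rightarrow> complex" where
  "mat_trace A = (\<Sum>i < dim_row A. A $$ (i, i))"

definition character :: "'a rep \<Rightarrow> 'a \<Rightarrow> complex" where
  "character r g = mat_trace (snd r g)"

definition kronecker :: "complex mat \<Rightarrow> complex mat \<Rightarrow> complex mat" where
  "kronecker A B = mat (dim_row A * dim_row B) (dim_col A * dim_col B)
     (\<lambda>(i, j). A $$ (i div dim_row B, j div dim_col B) * B $$ (i mod dim_row B, j mod dim_col B))"

definition tensor_rep :: "'a rep \<Rightarrow> 'a rep \<Rightarrow> 'a rep" where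
  "tensor_rep r s = (fst r * fst s, \<lambda>g. kronecker (snd r g) (snd s g))"

definition one_dim_rep :: "('a \<Rightarrow> int) \<Rightarrow> 'a rep" where
  "one_dim_rep \<epsilon> = (1, \<lambda>g. mat 1 1 (\<lambda>_. of_int (\<epsilon> g)))"

definition twist :: "('a \<Rightarrow> int) \<Rightarrow> 'a rep \<Rightarrow> 'a rep" where
  "twist \<epsilon> r = tensor_rep r (one_dim_rep \<epsilon>)"


section \<open>Conjugacy classes\<close>

definition conj_classes :: "('a, 'b) monoid_scheme \<Rightarrow> 'a set set" where
  "conj_classes G =
     orbits G (carrier G) (\<lambda>g. \<lambda>h \<in> carrier G. g \<otimes>\<^bsub>G\<^esub> h \<otimes>\<^bsub>G\<^esub> inv\<^bsub>G\<^esub> g)"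

text \<open>The common value on \<open>c\<close> of a function \<open>f\<close> that is constant on the nonempty set \<open>c\<close>.\<close>

definition class_value :: "('a \<Rightarrow> int) \<Rightarrow> 'a set \<Rightarrow> int" where
  "class_value f c = the_elem (f ` c)"


section \<open>Partitions, cycle types and Young diagrams\<close>

definition partitions :: "nat \<Rightarrow> nat list set" where
  "partitions d = {l. sorted_wrt (\<ge>) l \<and> 0 \<notin> set l \<and> sum_list l = d}"

text \<open>The multiset of the cycle lengths (fixed points included) of a permutation of \<open>{1..d}\<close>.\<close>

definition cycle_type :: "nat \<Rightarrow> (nat \<Rightarrow> nat) \<Rightarrow> nat multiset" where
  "cycle_type d p = image_mset card (mset_set (Orbits.orbit p ` {1..d}))"

definition cycle_class :: "nat \<Rightarrow> nat list \<Rightarrow> (nat \<Rightarrow> nat) set" where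
  "cycle_class d l = {p \<in> carrier (sym_group d). cycle_type d p = mset l}"

definition young_diagram :: "nat list \<Rightarrow> (nat \<times> nat) set" where
  "young_diagram l = {(i, j). i < length l \<and> j < l ! i}"

definition symmetric_young_diagrams :: "nat \<Rightarrow> (nat \<times> nat) set set" where
  "symmetric_young_diagrams d = {D \<in> young_diagram ` partitions d. prod.swap ` D = D}"

end

theory Submission
  imports Defs "Jordan_Normal_Form.Spectral_Radius"
begin

text \<open>
  The first count is the trace of multiplication by \<open>\<epsilon>\<close> on the space of class functions
  of \<open>G\<close>, computed in two bases. In the basis of indicator functions of the conjugacy classes it
  is diagonal, with trace \<open>\<Sum>\<^sub>c \<epsilon>(c)\<close>. In the basis of irreducible characters it is a
  permutation, since multiplying by \<open>\<epsilon>\<close> turns the character of \<open>\<rho>\<close> into that of its twist, and the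
  trace of a permutation is its number of fixed points. Written out with scalar products, three
  facts are combined:
  \<^item> orbit-stabilizer for conjugation: \<open>\<bar>G\<bar> \<cdot> \<Sum>\<^sub>c \<epsilon>(c) = \<Sum>\<^sub>g \<epsilon>(g) \<cdot> \<bar>C(g)\<bar>\<close>, where \<open>C(g)\<close> is the
    centralizer (\<open>sum_sign_stabilizer\<close>);
  \<^item> column orthogonality: \<open>\<bar>C(g)\<bar> = \<Sum>\<^sub>\<chi> \<chi>(g) \<cdot> \<chi>(inv g)\<close>, summed over the irreducible characters
    (\<open>column_orthogonality\<close>);
  \<^item> row orthogonality: \<open>\<Sum>\<^sub>g \<epsilon>(g) \<cdot> \<chi>(g) \<cdot> \<chi>(inv g)\<close> is \<open>\<bar>G\<bar>\<close> if the representation with character \<open>\<chi>\<close>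
    is isomorphic to its twist, and \<open>0\<close> otherwise (\<open>character_orthogonality\<close>).

  Row orthogonality is Schur's lemma applied to averages of matrix units. Column orthogonality
  amounts to the completeness of the irreducible characters (\<open>class_function_eq_0\<close>). For a class
  function \<open>f\<close> the matrix \<open>\<Sum>\<^sub>g f(g) \<rho>(g)\<close> commutes with the representation \<open>\<rho>\<close>. If \<open>f\<close> is orthogonal
  to all irreducible characters, the matrix vanishes for irreducible \<open>\<rho>\<close>, because it is then a
  scalar of trace \<open>0\<close>; it therefore vanishes for unitary \<open>\<rho>\<close>, which split orthogonally into
  smaller pieces, and in particular for the regular representation, whose matrices are linearly
  independent.

  The count of symmetric Young diagrams is proved by bijections. A permutation of \<open>d\<close> points with
  cycle type \<open>\<lambda>\<close> has sign \<open>(- 1)\<^sup>d\<^sup>-\<^sup>l\<close>, where \<open>l\<close> is the number of parts of \<open>\<lambda>\<close>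
  (\<open>class_value_sign\<close>). Replacing one part \<open>2a\<close> by two parts \<open>a, a\<close> changes this sign. With a suitable
  choice of \<open>a\<close>, these replacements match up all partitions that have an even or a repeated part,
  so that they cancel (\<open>not_distinct_odd_eq\<close>), and each of the remaining partitions, those into
  distinct odd parts, contributes \<open>+1\<close>. On the other side, a symmetric diagram is the union of
  the hooks at its diagonal cells, whose sizes are distinct odd numbers that determine it
  (\<open>hook_diagram_properties\<close>, \<open>inj_on_hook_diagram\<close>, \<open>hook_diagram_surj\<close>).
\<close>

section \<open>Isometries and invariant subspaces\<close>

lemma mat_adjoint_dim [simp]:
  "dim_row (mat_adjoint A) = dim_col A" "dim_col (mat_adjoint A) = dim_row A"
  by (simp_all add: mat_adjoint_def)

lemma mat_adjoint_carrier [simp]: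
  "A \<in> carrier_mat n m \<Longrightarrow> mat_adjoint A \<in> carrier_mat m n"
  by auto

lemma mat_adjoint_index [simp]:
  "i < dim_col A \<Longrightarrow> j < dim_row A \<Longrightarrow> mat_adjoint A $$ (i, j) = cnj (A $$ (j, i))"
  by (simp add: mat_adjoint_def mat_of_rows_index)

lemma mat_adjoint_adjoint [simp]:
  fixes A :: "complex mat"
  shows "mat_adjoint (mat_adjoint A) = A"
  by (rule eq_matI) auto

lemma mat_adjoint_mult:
  fixes A B :: "complex mat"
  assumes "dim_col A = dim_row B"
  shows "mat_adjoint (A * B) = mat_adjoint B * mat_adjoint A"
  using assms by (intro eq_matI) (auto simp: scalar_prod_def mult.commute)

text \<open>
  Associativity with conditions on dimensions only. In contrast to the version with carrier sets,
  this can be used as a rewrite rule, since no dimension has to be guessed.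
\<close>
lemma mat_mult_assoc_dim:
  "dim_col A = dim_row B \<Longrightarrow> dim_col B = dim_row C \<Longrightarrow>
    A * B * C = A * (B * (C :: 'x :: semiring_0 mat))"
  by (rule assoc_mult_mat) auto

lemma mat_vec_assoc_dim:
  "dim_col A = dim_row B \<Longrightarrow> dim_col B = dim_vec v \<Longrightarrow>
    (A * B) *\<^sub>v v = A *\<^sub>v (B *\<^sub>v (v :: 'x :: semiring_0 vec))"
  by (rule assoc_mult_mat_vec) auto

lemma mat_trace_mult:
  assumes "A \<in> carrier_mat n m" "B \<in> carrier_mat m n"
  shows "mat_trace (A * B) = (\<Sum>i<n. \<Sum>j<m. A $$ (i, j) * B $$ (j, i))"
  using assms by (auto simp: mat_trace_def scalar_prod_def lessThan_atLeast0 intro!: sum.cong)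

lemma mat_trace_comm:
  assumes "A \<in> carrier_mat n m" "B \<in> carrier_mat m n"
  shows "mat_trace (A * B) = mat_trace (B * A)"
  unfolding mat_trace_mult[OF assms] mat_trace_mult[OF assms(2,1)]
  by (subst sum.swap) (simp add: mult.commute)

lemma mat_trace_one [simp]: "mat_trace (1\<^sub>m n) = of_nat n"
  by (simp add: mat_trace_def)

text \<open>
  Were \<open>n < k\<close>, one could pad \<open>A\<close> and \<open>B\<close> with zeros to square matrices that are still inverse to
  each other on one side, hence on both; but the other product has a zero on its diagonal. This bounds
  both the size of an orthonormal family and the number of irreducible characters.
\<close>
lemma left_inverse_dim_le:
  fixes A B :: "complex mat"
  assumes A: "A \<in> carrier_mat k n" and B: "B \<in> carrier_mat n k" and AB: "A * B = 1\<^sub>m k"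
  shows "k \<le> n"
proof (rule ccontr)
  assume "\<not> k \<le> n"
  define A' where "A' = mat k k (\<lambda>(i, j). if j < n then A $$ (i, j) else 0)"
  define B' where "B' = mat k k (\<lambda>(i, j). if i < n then B $$ (i, j) else 0)"
  have "A' * B' = 1\<^sub>m k"
  proof (rule eq_matI)
    fix i j assume "i < dim_row (1\<^sub>m k :: complex mat)" "j < dim_col (1\<^sub>m k :: complex mat)"
    then have i: "i < k" and j: "j < k" by auto
    have "(A' * B') $$ (i, j) = (\<Sum>l<k. if l < n then A $$ (i, l) * B $$ (l, j) else 0)"
      using i j by (auto simp: A'_def B'_def scalar_prod_def lessThan_atLeast0 intro!: sum.cong)
    also have "\<dots> = (\<Sum>l<n. A $$ (i, l) * B $$ (l, j))"
      using \<open>\<not> k \<le> n\<close> by (intro sum.mono_neutral_cong_right) auto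
    also have "\<dots> = (A * B) $$ (i, j)"
      using A B i j by (simp add: scalar_prod_def lessThan_atLeast0)
    finally show "(A' * B') $$ (i, j) = 1\<^sub>m k $$ (i, j)" by (simp add: AB)
  qed (auto simp: A'_def B'_def)
  then have "B' * A' = 1\<^sub>m k"
    by (rule mat_mult_left_right_inverse[of A' k B', rotated 2]) (simp_all add: A'_def B'_def)
  then have "(B' * A') $$ (n, n) = 1" using \<open>\<not> k \<le> n\<close> by simp
  moreover have "(B' * A') $$ (n, n) = 0"
    using \<open>\<not> k \<le> n\<close> by (simp add: A'_def B'_def scalar_prod_def)
  ultimately show False by simp
qed

text \<open>
  The closure conditions of a subspace of \<open>\<complex>\<^sup>n\<close>, free of the record structure of modules.
\<close>
definition lin_subspace :: "nat \<Rightarrow> complex vec set \<Rightarrow> bool" where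
  "lin_subspace n W \<longleftrightarrow> W \<subseteq> carrier_vec n \<and> 0\<^sub>v n \<in> W \<and>
     (\<forall>v \<in> W. \<forall>w \<in> W. v + w \<in> W) \<and> (\<forall>c. \<forall>w \<in> W. c \<cdot>\<^sub>v w \<in> W)"

lemma subspace_iff_lin_subspace:
  "VectorSpace.subspace class_ring W (module_vec TYPE(complex) n) \<longleftrightarrow> lin_subspace n W"
proof -
  have "submodule class_ring W (module_vec TYPE(complex) n) \<longleftrightarrow> lin_subspace n W"
    unfolding submodule_def lin_subspace_def using vec_module[where ?'a=complex]
    by (auto simp: module_vec_simps)
  then show ?thesis
    unfolding VectorSpace.subspace_def using vec_vs by blast
qed

text \<open>
  The columns of \<open>B\<close> are an orthonormal basis of \<open>W\<close>, so that \<open>B B\<^sup>*\<close> is the orthogonal projection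
  onto \<open>W\<close>. Such a \<open>B\<close> is found as a largest orthonormal family in \<open>W\<close>: if the projection moved some
  \<open>w\<close> in \<open>W\<close>, the normalized difference would be a further member. Requiring \<open>B x \<in> W\<close> for all \<open>x\<close>,
  rather than for the columns of \<open>B\<close>, avoids linear combinations of families.
\<close>
lemma isometry_onto_subspace:
  assumes W: "lin_subspace n W"
  obtains k B where "B \<in> carrier_mat n k" "mat_adjoint B * B = 1\<^sub>m k"
    "\<And>x. x \<in> carrier_vec k \<Longrightarrow> B *\<^sub>v x \<in> W"
    "\<And>w. w \<in> W \<Longrightarrow> (B * mat_adjoint B) *\<^sub>v w = w"
proof -
  define Q where "Q k \<longleftrightarrow> (\<exists>B \<in> carrier_mat n k. mat_adjoint B * B = 1\<^sub>m k \<and>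
    (\<forall>x \<in> carrier_vec k. B *\<^sub>v x \<in> W))" for k
  have "Q 0" unfolding Q_def
  proof (intro bexI[of _ "0\<^sub>m n 0"] conjI ballI)
    show "mat_adjoint (0\<^sub>m n 0) * 0\<^sub>m n 0 = (1\<^sub>m 0 :: complex mat)"
      by (rule eq_matI) (auto simp: mat_adjoint_def)
    fix x :: "complex vec" assume "x \<in> carrier_vec 0"
    then have "0\<^sub>m n 0 *\<^sub>v x = 0\<^sub>v n" by (intro eq_vecI) (auto simp: scalar_prod_def)
    then show "0\<^sub>m n 0 *\<^sub>v x \<in> W" using W by (simp add: lin_subspace_def)
  qed simp
  moreover have "\<forall>k. Q k \<longrightarrow> k \<le> n" unfolding Q_def
    using left_inverse_dim_le mat_adjoint_carrier by blast
  ultimately obtain k where k: "Q k" and max: "\<And>l. Q l \<Longrightarrow> l \<le> k"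
    by (metis Greatest_le_nat GreatestI_nat)
  from k obtain B where B: "B \<in> carrier_mat n k" and iso: "mat_adjoint B * B = 1\<^sub>m k"
    and BW: "\<And>x. x \<in> carrier_vec k \<Longrightarrow> B *\<^sub>v x \<in> W" by (auto simp: Q_def)
  note aB = mat_adjoint_carrier[OF B]
  have "(B * mat_adjoint B) *\<^sub>v w = w" if w: "w \<in> W" for w
  proof (rule ccontr)
    assume neq: "(B * mat_adjoint B) *\<^sub>v w \<noteq> w"
    have wn: "w \<in> carrier_vec n" using w W by (auto simp: lin_subspace_def)
    define p where "p = B *\<^sub>v (mat_adjoint B *\<^sub>v w)"
    \<comment> \<open>The part of \<open>w\<close> orthogonal to the columns of \<open>B\<close>.\<close>
    define u where "u = w + (-1) \<cdot>\<^sub>v p"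
    have pn: "p \<in> carrier_vec n" unfolding p_def using mult_mat_vec_carrier[OF B mult_mat_vec_carrier[OF aB wn]] .
    have un: "u \<in> carrier_vec n" using pn wn by (simp add: u_def)
    have "p \<in> W" unfolding p_def by (intro BW mult_mat_vec_carrier[OF aB wn])
    then have uW: "u \<in> W" using w W by (simp add: u_def lin_subspace_def)
    have u0: "u \<noteq> 0\<^sub>v n"
    proof
      assume "u = 0\<^sub>v n"
      then have "w = p" using pn wn by (auto simp: u_def vec_eq_iff)
      then show False using neq B aB wn by (simp add: p_def)
    qed
    have Bu: "mat_adjoint B *\<^sub>v u = 0\<^sub>v k"
    proof -
      have "mat_adjoint B *\<^sub>v p = mat_adjoint B *\<^sub>v w"
        using mat_vec_assoc_dim[of "mat_adjoint B" B "mat_adjoint B *\<^sub>v w"] B wn aB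
        by (simp add: p_def iso)
      then have "mat_adjoint B *\<^sub>v u = mat_adjoint B *\<^sub>v w + (-1) \<cdot>\<^sub>v (mat_adjoint B *\<^sub>v w)"
        unfolding u_def using aB wn pn by (simp add: mult_add_distrib_mat_vec[OF aB] mult_mat_vec[OF aB])
      also have "\<dots> = 0\<^sub>v k" using aB wn by (intro eq_vecI) auto
      finally show ?thesis .
    qed
    define s where "s = (\<Sum>i<n. (cmod (u $ i))\<^sup>2)"
    have "s > 0"
    proof -
      from u0 un obtain i where "i < n" "u $ i \<noteq> 0" by (auto simp: vec_eq_iff)
      then have "0 < (cmod (u $ i))\<^sup>2" by simp
      also have "\<dots> \<le> s" unfolding s_def using \<open>i < n\<close> by (intro member_le_sum) auto
      finally show ?thesis .
    qed
    define c where "c = complex_of_real (1 / sqrt s)"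
    have cc: "c * cnj c * of_real s = 1"
    proof -
      have "(1 / sqrt s) * (1 / sqrt s) * s = 1" using \<open>s > 0\<close> by (simp add: field_simps)
      then show ?thesis unfolding c_def by (metis complex_cnj_complex_of_real of_real_1 of_real_mult)
    qed
    \<comment> \<open>\<open>B\<close> with the normalized vector \<open>c u\<close> as an additional last column.\<close>
    define B' where "B' = mat n (Suc k) (\<lambda>(i, j). if j < k then B $$ (i, j) else c * u $ i)"
    have B': "B' \<in> carrier_mat n (Suc k)" by (simp add: B'_def)
    note aB' = mat_adjoint_carrier[OF B']
    have Bu': "(\<Sum>l<n. cnj (B $$ (l, i)) * u $ l) = 0" if "i < k" for i
      using arg_cong[OF Bu, of "\<lambda>v. v $ i"] that aB un B
      by (simp add: scalar_prod_def lessThan_atLeast0)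
    have Bu'': "(\<Sum>l<n. cnj (u $ l) * B $$ (l, i)) = 0" if "i < k" for i
      using arg_cong[OF Bu'[OF that], of cnj] by (simp add: mult.commute)
    have BB: "(\<Sum>l<n. cnj (B $$ (l, i)) * B $$ (l, j)) = (if i = j then 1 else 0)" if "i < k" "j < k" for i j
      using arg_cong[OF iso, of "\<lambda>M. M $$ (i, j)"] that aB B
      by (simp add: scalar_prod_def lessThan_atLeast0)
    have uu: "(\<Sum>l<n. cnj (u $ l) * u $ l) = of_real s"
      unfolding s_def of_real_sum by (intro sum.cong refl) (simp only: complex_norm_square mult.commute)
    have "Q (Suc k)" unfolding Q_def
    proof (intro bexI[OF _ B'] conjI ballI)
      show "mat_adjoint B' * B' = 1\<^sub>m (Suc k)"
      proof (rule eq_matI)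
        fix i j assume "i < dim_row (1\<^sub>m (Suc k) :: complex mat)" "j < dim_col (1\<^sub>m (Suc k) :: complex mat)"
        then have i: "i < Suc k" and j: "j < Suc k" by auto
        have "(mat_adjoint B' * B') $$ (i, j) = (\<Sum>l<n. cnj (B' $$ (l, i)) * B' $$ (l, j))"
          using i j aB' B' by (simp add: scalar_prod_def lessThan_atLeast0)
        also have "\<dots> = (if i = j then 1 else 0)"
        proof (cases "i < k"; cases "j < k")
          assume "i < k" "j < k"
          then show ?thesis by (simp add: B'_def BB)
        next
          assume "i < k" "\<not> j < k"
          then have "(\<Sum>l<n. cnj (B' $$ (l, i)) * B' $$ (l, j)) = c * (\<Sum>l<n. cnj (B $$ (l, i)) * u $ l)"
            using j by (simp add: B'_def sum_distrib_left mult_ac)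
          then show ?thesis using \<open>i < k\<close> \<open>\<not> j < k\<close> by (auto simp: Bu')
        next
          assume "\<not> i < k" "j < k"
          then have "(\<Sum>l<n. cnj (B' $$ (l, i)) * B' $$ (l, j)) = cnj c * (\<Sum>l<n. cnj (u $ l) * B $$ (l, j))"
            using i by (simp add: B'_def sum_distrib_left mult_ac)
          then show ?thesis using \<open>\<not> i < k\<close> \<open>j < k\<close> by (auto simp: Bu'')
        next
          assume nij: "\<not> i < k" "\<not> j < k"
          then have "(\<Sum>l<n. cnj (B' $$ (l, i)) * B' $$ (l, j)) = c * cnj c * (\<Sum>l<n. cnj (u $ l) * u $ l)"
            using i j by (simp add: B'_def sum_distrib_left mult_ac)
          then show ?thesis using nij i j by (simp add: uu cc)
        qed
        finally show "(mat_adjoint B' * B') $$ (i, j) = 1\<^sub>m (Suc k) $$ (i, j)" using i j by simp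
      qed (use aB' B' in auto)
      fix x :: "complex vec" assume x: "x \<in> carrier_vec (Suc k)"
      have "B' *\<^sub>v x = B *\<^sub>v vec k (\<lambda>i. x $ i) + (c * x $ k) \<cdot>\<^sub>v u"
        using B B' x un by (intro eq_vecI) (auto simp: scalar_prod_def B'_def mult_ac)
      moreover have "B *\<^sub>v vec k (\<lambda>i. x $ i) \<in> W" by (rule BW) simp
      ultimately show "B' *\<^sub>v x \<in> W" using uW W by (simp add: lin_subspace_def)
    qed
    from max[OF this] show False by simp
  qed
  from that[OF B iso BW this] show ?thesis .
qed

section \<open>Representations and intertwiners\<close>

lemma repsD:
  assumes "group G" "(n, \<rho>) \<in> reps G"
  shows "\<And>g. g \<in> carrier G \<Longrightarrow> \<rho> g \<in> carrier_mat n n"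
    "\<And>g h. g \<in> carrier G \<Longrightarrow> h \<in> carrier G \<Longrightarrow> \<rho> (g \<otimes>\<^bsub>G\<^esub> h) = \<rho> g * \<rho> h"
    "\<rho> \<one>\<^bsub>G\<^esub> = 1\<^sub>m n"
    "\<And>g. g \<in> carrier G \<Longrightarrow> \<rho> g * \<rho> (inv\<^bsub>G\<^esub> g) = 1\<^sub>m n"
    "\<And>g. g \<in> carrier G \<Longrightarrow> \<rho> (inv\<^bsub>G\<^esub> g) * \<rho> g = 1\<^sub>m n"
proof -
  interpret G: group G by fact
  interpret M: semiring "ring_mat TYPE(complex) n ()" by (rule semiring_mat)
  interpret L: group "GL n" unfolding GL_def by (rule M.units_group)
  have h: "\<rho> \<in> hom G (GL n)" using assms(2) by (simp add: reps_def)
  interpret h: group_hom G "GL n" \<rho> by unfold_locales (rule h)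
  have c: "carrier (GL n) \<subseteq> carrier_mat n n"
    by (auto simp: GL_def units_of_def Units_def ring_mat_simps)
  have m: "x \<otimes>\<^bsub>GL n\<^esub> y = x * y" and o: "one (GL n) = 1\<^sub>m n"
    for x y by (simp_all add: GL_def units_of_def ring_mat_simps)
  show 1: "\<And>g. g \<in> carrier G \<Longrightarrow> \<rho> g \<in> carrier_mat n n"
    using h.hom_closed c by blast
  show 2: "\<And>g h. g \<in> carrier G \<Longrightarrow> h \<in> carrier G \<Longrightarrow> \<rho> (g \<otimes>\<^bsub>G\<^esub> h) = \<rho> g * \<rho> h"
    using h.hom_mult by (simp add: m)
  show 3: "\<rho> \<one>\<^bsub>G\<^esub> = 1\<^sub>m n" using h.hom_one by (simp add: o)
  show "\<rho> g * \<rho> (inv\<^bsub>G\<^esub> g) = 1\<^sub>m n" "\<rho> (inv\<^bsub>G\<^esub> g) * \<rho> g = 1\<^sub>m n" if "g \<in> carrier G" for g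
    using 2[of g "inv\<^bsub>G\<^esub> g"] 2[of "inv\<^bsub>G\<^esub> g" g] 3 that by simp_all
qed

lemma repsI:
  assumes "group G" "\<And>g. g \<in> carrier G \<Longrightarrow> \<rho> g \<in> carrier_mat n n"
    "\<And>g h. g \<in> carrier G \<Longrightarrow> h \<in> carrier G \<Longrightarrow> \<rho> (g \<otimes>\<^bsub>G\<^esub> h) = \<rho> g * \<rho> h"
    "\<rho> \<one>\<^bsub>G\<^esub> = 1\<^sub>m n"
  shows "(n, \<rho>) \<in> reps G"
proof -
  interpret G: group G by fact
  have i: "\<rho> g * \<rho> (inv\<^bsub>G\<^esub> g) = 1\<^sub>m n" "\<rho> (inv\<^bsub>G\<^esub> g) * \<rho> g = 1\<^sub>m n" if "g \<in> carrier G" for g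
    using assms(3)[of g "inv\<^bsub>G\<^esub> g"] assms(3)[of "inv\<^bsub>G\<^esub> g" g] assms(4) that by simp_all
  have "\<rho> g \<in> carrier (GL n)" if "g \<in> carrier G" for g
    using i[OF that] assms(2)[OF that] assms(2)[of "inv\<^bsub>G\<^esub> g"] that
    unfolding GL_def units_of_def Units_def by (auto simp: ring_mat_simps)
  then show ?thesis
    by (simp add: reps_def hom_def assms(3)) (simp add: GL_def units_of_def ring_mat_simps)
qed

lemma irrepsD:
  assumes "(n, \<rho>) \<in> irreps G"
  shows "(n, \<rho>) \<in> reps G" "n > 0"
    "\<And>W. lin_subspace n W \<Longrightarrow> (\<And>g w. g \<in> carrier G \<Longrightarrow> w \<in> W \<Longrightarrow> \<rho> g *\<^sub>v w \<in> W)
      \<Longrightarrow> W = {0\<^sub>v n} \<or> W = carrier_vec n"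
  using assms by (auto simp: irreps_def subspace_iff_lin_subspace)

lemma not_irrepsE:
  assumes "(n, \<rho>) \<in> reps G" "(n, \<rho>) \<notin> irreps G" "n > 0"
  obtains W where "lin_subspace n W" "\<And>g w. g \<in> carrier G \<Longrightarrow> w \<in> W \<Longrightarrow> \<rho> g *\<^sub>v w \<in> W"
    "W \<noteq> {0\<^sub>v n}" "W \<noteq> carrier_vec n"
  using assms by (auto simp: irreps_def subspace_iff_lin_subspace)

lemma kernel_lin_subspace:
  assumes A: "A \<in> carrier_mat m n"
  shows "lin_subspace n {v \<in> carrier_vec n. A *\<^sub>v v = 0\<^sub>v m}"
  unfolding lin_subspace_def
proof (intro conjI ballI allI)
  show "0\<^sub>v n \<in> {v \<in> carrier_vec n. A *\<^sub>v v = 0\<^sub>v m}" using A by auto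
qed (use A in \<open>auto simp: mult_add_distrib_mat_vec[OF A] mult_mat_vec[OF A]\<close>)

lemma smult_mat_mult_vec:
  "dim_col A = dim_vec v \<Longrightarrow> (c \<cdot>\<^sub>m A) *\<^sub>v v = c \<cdot>\<^sub>v (A *\<^sub>v (v :: complex vec))"
  by (rule eq_vecI) auto

lemma image_lin_subspace:
  assumes A: "A \<in> carrier_mat m n"
  shows "lin_subspace m ((*\<^sub>v) A ` carrier_vec n)"
  unfolding lin_subspace_def
proof (intro conjI ballI allI)
  show "0\<^sub>v m \<in> (*\<^sub>v) A ` carrier_vec n" using A by (intro image_eqI[of _ _ "0\<^sub>v n"]) auto
next
  fix v w assume "v \<in> (*\<^sub>v) A ` carrier_vec n" "w \<in> (*\<^sub>v) A ` carrier_vec n"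
  then obtain x y where "v = A *\<^sub>v x" "w = A *\<^sub>v y" "x \<in> carrier_vec n" "y \<in> carrier_vec n" by auto
  then show "v + w \<in> (*\<^sub>v) A ` carrier_vec n"
    by (intro image_eqI[of _ _ "x + y"]) (auto simp: mult_add_distrib_mat_vec[OF A])
next
  fix c w assume "w \<in> (*\<^sub>v) A ` carrier_vec n"
  then obtain y where "w = A *\<^sub>v y" "y \<in> carrier_vec n" by auto
  then show "c \<cdot>\<^sub>v w \<in> (*\<^sub>v) A ` carrier_vec n"
    by (intro image_eqI[of _ _ "c \<cdot>\<^sub>v y"]) (auto simp: mult_mat_vec[OF A])
qed (use A in auto)

lemma mat_eq_vecI:
  assumes "A \<in> carrier_mat m n" "B \<in> carrier_mat m n"
    and "\<And>v. v \<in> carrier_vec n \<Longrightarrow> A *\<^sub>v v = B *\<^sub>v (v :: 'x :: semiring_1 vec)"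
  shows "A = B"
proof (rule eq_matI)
  fix i j assume ij: "i < dim_row B" "j < dim_col B"
  have "(A *\<^sub>v unit_vec n j) $ i = (B *\<^sub>v unit_vec n j) $ i" using assms(3) by simp
  then show "A $$ (i, j) = B $$ (i, j)" using assms(1,2) ij by simp
qed (use assms in auto)

text \<open>
  That \<open>A\<close> is square is seen by comparing traces: a right inverse \<open>R\<close> exists by surjectivity and is
  also a left inverse by injectivity, so \<open>m = tr (A R) = tr (R A) = n\<close>.
\<close>
lemma bijective_imp_invertible:
  fixes A :: "complex mat"
  assumes A: "A \<in> carrier_mat m n"
    and inj: "\<And>v. v \<in> carrier_vec n \<Longrightarrow> A *\<^sub>v v = 0\<^sub>v m \<Longrightarrow> v = 0\<^sub>v n"
    and surj: "carrier_vec m \<subseteq> (*\<^sub>v) A ` carrier_vec n"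
  shows "m = n" "invertible_mat A"
proof -
  have "\<exists>x \<in> carrier_vec n. A *\<^sub>v x = unit_vec m j" for j
    using surj unit_vec_carrier[of m j] by fastforce
  then obtain x where x: "\<And>j. x j \<in> carrier_vec n" "\<And>j. A *\<^sub>v x j = unit_vec m j" by metis
  define R where "R = mat n m (\<lambda>(i, j). x j $ i)"
  have R: "R \<in> carrier_mat n m" by (simp add: R_def)
  have AR: "A * R = 1\<^sub>m m"
  proof (rule eq_matI)
    fix i j assume ij: "i < dim_row (1\<^sub>m m :: complex mat)" "j < dim_col (1\<^sub>m m :: complex mat)"
    have "col R j = x j" using ij x(1)[of j] by (intro eq_vecI) (auto simp: R_def)
    then have "(A * R) $$ (i, j) = (A *\<^sub>v x j) $ i" using ij A R by simp
    then show "(A * R) $$ (i, j) = 1\<^sub>m m $$ (i, j)" using ij by (simp add: x(2))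
  qed (use A R in auto)
  have RA: "R * A = 1\<^sub>m n"
  proof (rule mat_eq_vecI)
    fix v :: "complex vec" assume v: "v \<in> carrier_vec n"
    let ?d = "R *\<^sub>v (A *\<^sub>v v) + (-1) \<cdot>\<^sub>v v"
    have c: "R *\<^sub>v (A *\<^sub>v v) \<in> carrier_vec n" using A R v by (intro mult_mat_vec_carrier)
    have "A *\<^sub>v (R *\<^sub>v (A *\<^sub>v v)) = (A * R) *\<^sub>v (A *\<^sub>v v)"
      using A R v by (intro mat_vec_assoc_dim[symmetric]) auto
    also have "\<dots> = A *\<^sub>v v" using A v by (simp add: AR)
    finally have "A *\<^sub>v ?d = A *\<^sub>v v + (-1) \<cdot>\<^sub>v (A *\<^sub>v v)"
      using c v by (simp add: mult_add_distrib_mat_vec[OF A] mult_mat_vec[OF A])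
    also have "\<dots> = 0\<^sub>v m" using A v by (intro eq_vecI) auto
    finally have "?d = 0\<^sub>v n" using c v by (intro inj) auto
    then have "R *\<^sub>v (A *\<^sub>v v) = v" using c v R by (auto simp: vec_eq_iff)
    then show "(R * A) *\<^sub>v v = 1\<^sub>m n *\<^sub>v v" using mat_vec_assoc_dim[of R A v] A R v by simp
  qed (use A R in auto)
  show mn: "m = n"
    using mat_trace_comm[OF A R] by (simp add: AR RA)
  show "invertible_mat A"
    unfolding invertible_mat_def inverts_mat_def using A R AR RA mn by auto
qed

text \<open>
  Kernel and image of an intertwiner are invariant subspaces, so irreducibility leaves only
  \<open>0\<close> and the whole space for each of them.
\<close>
lemma schur_invertible:
  assumes G: "group G" and r: "(n, \<rho>) \<in> irreps G" and s: "(m, \<sigma>) \<in> irreps G"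
    and A: "A \<in> carrier_mat m n" and comm: "\<And>g. g \<in> carrier G \<Longrightarrow> A * \<rho> g = \<sigma> g * A"
    and nz: "A \<noteq> 0\<^sub>m m n"
  shows "m = n" "invertible_mat A"
proof -
  note r' = repsD[OF G irrepsD(1)[OF r]] and s' = repsD[OF G irrepsD(1)[OF s]]
  let ?K = "{v \<in> carrier_vec n. A *\<^sub>v v = 0\<^sub>v m}" and ?I = "(*\<^sub>v) A ` carrier_vec n"
  have comm_vec: "A *\<^sub>v (\<rho> g *\<^sub>v v) = \<sigma> g *\<^sub>v (A *\<^sub>v v)" if "g \<in> carrier G" "v \<in> carrier_vec n" for g v
    using mat_vec_assoc_dim[of A "\<rho> g" v] mat_vec_assoc_dim[of "\<sigma> g" A v]
      comm[OF that(1)] r'(1)[OF that(1)] s'(1)[OF that(1)] A that(2) by simp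
  have exv: "\<exists>v \<in> carrier_vec n. A *\<^sub>v v \<noteq> 0\<^sub>v m"
  proof (rule ccontr)
    assume "\<not> ?thesis"
    then have "A = 0\<^sub>m m n" using A by (intro mat_eq_vecI[OF A]) auto
    with nz show False by simp
  qed
  have "?K = {0\<^sub>v n} \<or> ?K = carrier_vec n"
  proof (rule irrepsD(3)[OF r kernel_lin_subspace[OF A]])
    fix g w assume "g \<in> carrier G" "w \<in> ?K"
    then show "\<rho> g *\<^sub>v w \<in> ?K" using r'(1)[of g] s'(1)[of g] by (auto simp: comm_vec)
  qed
  with exv have K: "?K = {0\<^sub>v n}" by blast
  have "?I = {0\<^sub>v m} \<or> ?I = carrier_vec m"
  proof (rule irrepsD(3)[OF s image_lin_subspace[OF A]])
    fix g w assume g: "g \<in> carrier G" and "w \<in> ?I"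
    then show "\<sigma> g *\<^sub>v w \<in> ?I" using r'(1)[OF g] by (auto simp: comm_vec[symmetric])
  qed
  with exv have "?I = carrier_vec m" by blast
  with K show "m = n" "invertible_mat A"
    using bijective_imp_invertible[OF A] by blast+
qed

text \<open>
  Over \<open>\<complex>\<close> the matrix \<open>A\<close> has an eigenvalue \<open>c\<close>, and \<open>A - c\<close> is an intertwiner that is not invertible,
  hence \<open>0\<close>.
\<close>
lemma schur_scalar:
  assumes G: "group G" and r: "(n, \<rho>) \<in> irreps G"
    and A: "A \<in> carrier_mat n n" and comm: "\<And>g. g \<in> carrier G \<Longrightarrow> A * \<rho> g = \<rho> g * A"
  obtains c where "A = c \<cdot>\<^sub>m 1\<^sub>m n"
proof -
  note r' = repsD[OF G irrepsD(1)[OF r]]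
  have "spectrum A \<noteq> {}" using spectrum_non_empty[OF A] irrepsD(2)[OF r] by simp
  then obtain c v where v: "v \<in> carrier_vec n" "v \<noteq> 0\<^sub>v n" "A *\<^sub>v v = c \<cdot>\<^sub>v v"
    using A by (auto simp: spectrum_def eigenvalue_def eigenvector_def)
  define B where "B = A + (- c) \<cdot>\<^sub>m 1\<^sub>m n"
  have B: "B \<in> carrier_mat n n" using A by (simp add: B_def)
  have "B * \<rho> g = \<rho> g * B" if "g \<in> carrier G" for g
    using r'(1)[OF that] A comm[OF that] mult_smult_distrib[OF r'(1)[OF that] one_carrier_mat, of "- c"]
    by (simp add: B_def add_mult_distrib_mat[of _ n n] mult_add_distrib_mat[of _ n n] mult_smult_assoc_mat[of _ n n])
  moreover
  have Bv: "B *\<^sub>v v = 0\<^sub>v n"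
  proof -
    have "B *\<^sub>v v = c \<cdot>\<^sub>v v + (- c) \<cdot>\<^sub>v v"
      using A v by (auto simp: B_def add_mult_distrib_mat_vec[of _ n n] smult_mat_mult_vec)
    then show ?thesis using v by auto
  qed
  have "\<not> invertible_mat B"
  proof
    assume "invertible_mat B"
    then obtain C where C: "B * C = 1\<^sub>m n" "C * B = 1\<^sub>m (dim_row C)"
      using B by (auto simp: invertible_mat_def inverts_mat_def)
    have "dim_col (C * B) = n" "dim_col (B * C) = n" using B C(1) by simp_all
    then have "C \<in> carrier_mat n n" using C B by (metis carrier_matI index_mult_mat(3) index_one_mat(3))
    then have "v = C *\<^sub>v (B *\<^sub>v v)" using mat_vec_assoc_dim[of C B v] C B v(1) by simp
    also have "\<dots> = 0\<^sub>v n" using Bv \<open>C \<in> carrier_mat n n\<close> by auto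
    finally show False using v by simp
  qed
  ultimately have "B = 0\<^sub>m n n" using schur_invertible[OF G r r B] by blast
  then have "A = c \<cdot>\<^sub>m 1\<^sub>m n"
    using A by (auto simp: B_def mat_eq_iff)
  then show ?thesis by (rule that)
qed

section \<open>Averaging and the orthogonality relations\<close>

text \<open>
  Matrices of all sizes share one type, which has no zero and hence no sum over a set; the sum is
  taken entrywise in a fixed size.
\<close>
definition mat_sum :: "nat \<Rightarrow> nat \<Rightarrow> 'a set \<Rightarrow> ('a \<Rightarrow> complex mat) \<Rightarrow> complex mat" where
  "mat_sum m n S F = mat m n (\<lambda>ij. \<Sum>g\<in>S. F g $$ ij)"

lemma mat_sum_carrier [simp]: "mat_sum m n S F \<in> carrier_mat m n"
  "dim_row (mat_sum m n S F) = m" "dim_col (mat_sum m n S F) = n"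
  by (simp_all add: mat_sum_def)

lemma mat_sum_index [simp]:
  "i < m \<Longrightarrow> j < n \<Longrightarrow> mat_sum m n S F $$ (i, j) = (\<Sum>g\<in>S. F g $$ (i, j))"
  by (simp add: mat_sum_def)

lemma mult_mat_sum:
  assumes A: "A \<in> carrier_mat k m" and F: "\<And>g. g \<in> S \<Longrightarrow> F g \<in> carrier_mat m n"
  shows "A * mat_sum m n S F = mat_sum k n S (\<lambda>g. A * F g)"
proof (rule eq_matI)
  fix i j assume "i < dim_row (mat_sum k n S (\<lambda>g. A * F g))" "j < dim_col (mat_sum k n S (\<lambda>g. A * F g))"
  then have i: "i < k" and j: "j < n" by simp_all
  have "(A * mat_sum m n S F) $$ (i, j) = (\<Sum>l<m. \<Sum>g\<in>S. A $$ (i, l) * F g $$ (l, j))"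
    using i j A by (simp add: scalar_prod_def sum_distrib_left lessThan_atLeast0)
  also have "\<dots> = (\<Sum>g\<in>S. \<Sum>l<m. A $$ (i, l) * F g $$ (l, j))" by (rule sum.swap)
  also have "\<dots> = (\<Sum>g\<in>S. (A * F g) $$ (i, j))"
    using i j A by (intro sum.cong refl) (auto dest!: F simp: scalar_prod_def lessThan_atLeast0)
  finally show "(A * mat_sum m n S F) $$ (i, j) = mat_sum k n S (\<lambda>g. A * F g) $$ (i, j)"
    using i j by simp
qed (use A in auto)

lemma mat_sum_mult:
  assumes A: "A \<in> carrier_mat n k" and F: "\<And>g. g \<in> S \<Longrightarrow> F g \<in> carrier_mat m n"
  shows "mat_sum m n S F * A = mat_sum m k S (\<lambda>g. F g * A)"
proof (rule eq_matI)
  fix i j assume "i < dim_row (mat_sum m k S (\<lambda>g. F g * A))" "j < dim_col (mat_sum m k S (\<lambda>g. F g * A))"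
  then have i: "i < m" and j: "j < k" by simp_all
  have "(mat_sum m n S F * A) $$ (i, j) = (\<Sum>l<n. \<Sum>g\<in>S. F g $$ (i, l) * A $$ (l, j))"
    using i j A by (simp add: scalar_prod_def sum_distrib_right lessThan_atLeast0)
  also have "\<dots> = (\<Sum>g\<in>S. \<Sum>l<n. F g $$ (i, l) * A $$ (l, j))" by (rule sum.swap)
  also have "\<dots> = (\<Sum>g\<in>S. (F g * A) $$ (i, j))"
    using i j A by (intro sum.cong refl) (auto dest!: F simp: scalar_prod_def lessThan_atLeast0)
  finally show "(mat_sum m n S F * A) $$ (i, j) = mat_sum m k S (\<lambda>g. F g * A) $$ (i, j)"
    using i j by simp
qed (use A in auto)

lemma mat_sum_reindex:
  assumes "bij_betw h S S" "\<And>g. g \<in> S \<Longrightarrow> F (h g) = E g"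
  shows "mat_sum m n S E = mat_sum m n S F"
proof (rule eq_matI)
  fix i j assume "i < dim_row (mat_sum m n S F)" "j < dim_col (mat_sum m n S F)"
  then show "mat_sum m n S E $$ (i, j) = mat_sum m n S F $$ (i, j)"
    using sum.reindex_bij_betw[OF assms(1), of "\<lambda>g. F g $$ (i, j)"] assms(2) by simp
qed simp_all

lemma mat_trace_mat_sum:
  "(\<And>g. g \<in> S \<Longrightarrow> F g \<in> carrier_mat n n) \<Longrightarrow>
    mat_trace (mat_sum n n S F) = (\<Sum>g\<in>S. mat_trace (F g))"
  unfolding mat_trace_def mat_sum_carrier
  by (simp, subst sum.swap, intro sum.cong refl) auto

lemma mat_trace_smult_one: "mat_trace (c \<cdot>\<^sub>m 1\<^sub>m n) = of_nat n * c"
  by (simp add: mat_trace_def)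

lemma (in group) left_mult_bij: "h \<in> carrier G \<Longrightarrow> bij_betw (\<lambda>g. h \<otimes> g) (carrier G) (carrier G)"
  by (rule bij_betwI[of _ _ _ "\<lambda>g. inv h \<otimes> g"]) (auto simp: m_assoc[symmetric])

lemma (in group) conj_bij:
  "h \<in> carrier G \<Longrightarrow> bij_betw (\<lambda>g. h \<otimes> g \<otimes> inv h) (carrier G) (carrier G)"
  using conjugation_is_bij[of h] bij_betw_cong[of "carrier G" "\<lambda>g \<in> carrier G. h \<otimes> g \<otimes> inv h" "\<lambda>g. h \<otimes> g \<otimes> inv h" "carrier G"]
  by simp

text \<open>
  Substituting \<open>h g\<close> for \<open>g\<close> in the sum moves \<open>\<sigma>(h)\<close> across it and leaves a factor \<open>\<rho>(h)\<close>.
\<close>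
lemma (in group) average_intertwines:
  assumes r: "(n, \<rho>) \<in> reps G" and s: "(m, \<sigma>) \<in> reps G" and X: "X \<in> carrier_mat m n"
    and h: "h \<in> carrier G"
  defines "A \<equiv> mat_sum m n (carrier G) (\<lambda>g. \<sigma> g * X * \<rho> (inv g))"
  shows "A * \<rho> h = \<sigma> h * A"
proof -
  note r' = repsD[OF is_group r] and s' = repsD[OF is_group s]
  let ?F = "\<lambda>g. \<sigma> g * X * \<rho> (inv g)"
  have F: "?F g \<in> carrier_mat m n" if "g \<in> carrier G" for g
    using r'(1)[of "inv g"] s'(1)[of g] X that by auto
  have "\<sigma> h * A = mat_sum m n (carrier G) (\<lambda>g. \<sigma> h * ?F g)"
    unfolding A_def by (rule mult_mat_sum[OF s'(1)[OF h] F])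
  also have "\<dots> = mat_sum m n (carrier G) (\<lambda>g. ?F g * \<rho> h)"
  proof (rule mat_sum_reindex[OF left_mult_bij[OF h]])
    fix g assume g: "g \<in> carrier G"
    have "\<rho> (inv (h \<otimes> g)) * \<rho> h = \<rho> (inv g)"
      using r'(2)[of "inv (h \<otimes> g)" h] g h by (simp add: inv_mult_group m_assoc)
    then have "?F (h \<otimes> g) * \<rho> h = \<sigma> (h \<otimes> g) * X * \<rho> (inv g)"
      using r'(1)[of h] r'(1)[of "inv (h \<otimes> g)"] s'(1)[of "h \<otimes> g"] X g h
        mat_mult_assoc_dim[of "\<sigma> (h \<otimes> g) * X" "\<rho> (inv (h \<otimes> g))" "\<rho> h"] by simp
    also have "\<dots> = \<sigma> h * ?F g"
      using s'(2)[OF h g] s'(1)[OF h] s'(1)[OF g] X r'(1)[of "inv g"] g by (simp add: mat_mult_assoc_dim)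
    finally show "?F (h \<otimes> g) * \<rho> h = \<sigma> h * ?F g" .
  qed
  also have "\<dots> = A * \<rho> h"
    unfolding A_def by (rule mat_sum_mult[OF r'(1)[OF h] F, symmetric])
  finally show ?thesis by simp
qed

definition mat_unit :: "nat \<Rightarrow> nat \<Rightarrow> nat \<Rightarrow> nat \<Rightarrow> complex mat" where
  "mat_unit m n i j = mat m n (\<lambda>(a, b). if a = i \<and> b = j then 1 else 0)"

lemma mat_unit_carrier [simp]: "mat_unit m n i j \<in> carrier_mat m n"
  by (simp add: mat_unit_def)

lemma mult_mat_unit_mult:
  assumes "A \<in> carrier_mat k m" "B \<in> carrier_mat n l" "i < m" "j < n" "a < k" "b < l"
  shows "(A * mat_unit m n i j * B) $$ (a, b) = A $$ (a, i) * B $$ (j, b)"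
proof -
  have "(A * mat_unit m n i j) $$ (a, c) = (if c = j then A $$ (a, i) else 0)" if "c < n" for c
    using assms that by (simp add: mat_unit_def scalar_prod_def if_distrib[of "\<lambda>x. _ * x"] sum.delta cong: if_cong)
  then show ?thesis
    using assms by (simp add: scalar_prod_def mat_unit_def if_distrib[of "\<lambda>x. x * _"] sum.delta cong: if_cong)
qed

text \<open>
  The \<open>(i, j)\<close> entry of the average of the \<open>(i, j)\<close> matrix unit is
  \<open>\<Sum>\<^sub>g \<sigma>(g)\<^sub>i\<^sub>i \<rho>(inv g)\<^sub>j\<^sub>j\<close>. This expresses the scalar product of two characters by intertwiners.
\<close>
lemma (in group) character_sum_expand:
  assumes r: "(n, \<rho>) \<in> reps G" and s: "(m, \<sigma>) \<in> reps G"
  shows "(\<Sum>g\<in>carrier G. character (m, \<sigma>) g * character (n, \<rho>) (inv g)) =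
    (\<Sum>i<m. \<Sum>j<n. mat_sum m n (carrier G) (\<lambda>g. \<sigma> g * mat_unit m n i j * \<rho> (inv g)) $$ (i, j))"
proof -
  note r' = repsD[OF is_group r] and s' = repsD[OF is_group s]
  have "(\<Sum>i<m. \<Sum>j<n. mat_sum m n (carrier G) (\<lambda>g. \<sigma> g * mat_unit m n i j * \<rho> (inv g)) $$ (i, j))
    = (\<Sum>i<m. \<Sum>j<n. \<Sum>g\<in>carrier G. \<sigma> g $$ (i, i) * \<rho> (inv g) $$ (j, j))"
    by (intro sum.cong refl, subst mat_sum_index)
       (auto intro!: sum.cong mult_mat_unit_mult[of _ _ _ _ _ n] r'(1) s'(1))
  also have "\<dots> = (\<Sum>g\<in>carrier G. \<Sum>i<m. \<Sum>j<n. \<sigma> g $$ (i, i) * \<rho> (inv g) $$ (j, j))"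
    by (subst (2) sum.swap, subst sum.swap[of _ "{..<n}"], rule refl)
  also have "\<dots> = (\<Sum>g\<in>carrier G. character (m, \<sigma>) g * character (n, \<rho>) (inv g))"
    using r'(1) s'(1) by (intro sum.cong refl) (auto simp: character_def mat_trace_def sum_product carrier_matD[OF r'(1)] carrier_matD[OF s'(1)])
  finally show ?thesis by simp
qed

lemma rep_isoE:
  assumes "((n, \<rho>), (m, \<sigma>)) \<in> rep_iso G"
  obtains P Q where "m = n" "P \<in> carrier_mat n n" "Q \<in> carrier_mat n n" "P * Q = 1\<^sub>m n" "Q * P = 1\<^sub>m n"
    "\<And>g. g \<in> carrier G \<Longrightarrow> P * \<rho> g = \<sigma> g * P" "(n, \<rho>) \<in> reps G" "(m, \<sigma>) \<in> reps G"
proof -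
  from assms obtain P where P: "P \<in> carrier_mat m n" "invertible_mat P"
    "\<And>g. g \<in> carrier G \<Longrightarrow> P * \<rho> g = \<sigma> g * P" "(n, \<rho>) \<in> reps G" "(m, \<sigma>) \<in> reps G"
    by (auto simp: rep_iso_def)
  have mn: "m = n" using P(1,2) by (auto simp: invertible_mat_def)
  obtain Q where Q: "P * Q = 1\<^sub>m n" "Q * P = 1\<^sub>m (dim_row Q)"
    using P(1,2) mn by (auto simp: invertible_mat_def inverts_mat_def)
  have "dim_row Q = n" "dim_col Q = n"
    using arg_cong[OF Q(1), of dim_col] arg_cong[OF Q(2), of dim_col] P(1) by simp_all
  then show thesis using that[of P Q] P Q mn by auto
qed

lemma rep_isoI:
  assumes "P \<in> carrier_mat n n" "Q \<in> carrier_mat n n" "P * Q = 1\<^sub>m n" "Q * P = 1\<^sub>m n"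
    "\<And>g. g \<in> carrier G \<Longrightarrow> P * \<rho> g = \<sigma> g * P" "(n, \<rho>) \<in> reps G" "(n, \<sigma>) \<in> reps G"
  shows "((n, \<rho>), (n, \<sigma>)) \<in> rep_iso G"
proof -
  have "invertible_mat P"
    unfolding invertible_mat_def inverts_mat_def using assms(1-4) by (auto intro!: exI[of _ Q])
  then show ?thesis using assms by (auto simp: rep_iso_def)
qed

lemma (in group) rep_iso_equiv: "equiv (reps G) (rep_iso G)"
proof (rule equivI)
  show "rep_iso G \<subseteq> reps G \<times> reps G" by (auto simp: rep_iso_def)
  show "refl_on (reps G) (rep_iso G)"
  proof (rule refl_onI)
    fix r assume r: "r \<in> reps G"
    obtain n \<rho> where [simp]: "r = (n, \<rho>)" by (cases r)
    show "(r, r) \<in> rep_iso G"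
      using r repsD(1)[OF is_group, of n \<rho>] unfolding \<open>r = (n, \<rho>)\<close>
      by (intro rep_isoI[of "1\<^sub>m n" n "1\<^sub>m n"])
        (auto simp: left_mult_one_mat[of _ n n] right_mult_one_mat[of _ n n])
  qed
  show "sym (rep_iso G)"
  proof (rule symI)
    fix r s assume *: "(r, s) \<in> rep_iso G"
    obtain n \<rho> m \<sigma> where [simp]: "r = (n, \<rho>)" "s = (m, \<sigma>)" by (cases r, cases s)
    from * obtain P Q where "m = n" and P: "P \<in> carrier_mat n n" and Q: "Q \<in> carrier_mat n n"
      and PQ: "P * Q = 1\<^sub>m n" "Q * P = 1\<^sub>m n"
      and c: "\<And>g. g \<in> carrier G \<Longrightarrow> P * \<rho> g = \<sigma> g * P" and r: "(n, \<rho>) \<in> reps G" and s: "(m, \<sigma>) \<in> reps G"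
      by (auto elim!: rep_isoE)
    have "Q * \<sigma> g = \<rho> g * Q" if g: "g \<in> carrier G" for g
    proof -
      have rg: "\<rho> g \<in> carrier_mat n n" and sg: "\<sigma> g \<in> carrier_mat n n"
        using repsD(1)[OF is_group r g] repsD(1)[OF is_group s g] \<open>m = n\<close> by auto
      have "Q * \<sigma> g = Q * (\<sigma> g * (P * Q))" using sg by (simp add: PQ)
      also have "\<dots> = Q * (\<sigma> g * P) * Q" using P Q sg by (simp add: mat_mult_assoc_dim)
      also have "\<dots> = Q * P * \<rho> g * Q" using P Q rg by (simp add: c[OF g, symmetric] mat_mult_assoc_dim)
      finally show ?thesis using rg PQ by simp
    qed
    then show "(s, r) \<in> rep_iso G"
      using rep_isoI[of Q n P G \<sigma> \<rho>] P Q PQ r s \<open>m = n\<close> by simp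
  qed
  show "trans (rep_iso G)"
  proof (rule transI)
    fix r s t assume *: "(r, s) \<in> rep_iso G" "(s, t) \<in> rep_iso G"
    obtain n \<rho> m \<sigma> k \<tau> where [simp]: "r = (n, \<rho>)" "s = (m, \<sigma>)" "t = (k, \<tau>)" by (cases r, cases s, cases t)
    from * obtain P Q where "m = n" and P: "P \<in> carrier_mat n n" and Q: "Q \<in> carrier_mat n n"
      and PQ: "P * Q = 1\<^sub>m n" "Q * P = 1\<^sub>m n"
      and c: "\<And>g. g \<in> carrier G \<Longrightarrow> P * \<rho> g = \<sigma> g * P" and r: "(n, \<rho>) \<in> reps G" and s: "(m, \<sigma>) \<in> reps G"
      by (auto elim!: rep_isoE)
    from * obtain P' Q' where "k = m" and P': "P' \<in> carrier_mat m m" and Q': "Q' \<in> carrier_mat m m"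
      and PQ': "P' * Q' = 1\<^sub>m m" "Q' * P' = 1\<^sub>m m"
      and c': "\<And>g. g \<in> carrier G \<Longrightarrow> P' * \<sigma> g = \<tau> g * P'" and t: "(k, \<tau>) \<in> reps G"
      by (auto elim!: rep_isoE)
    note [simp] = \<open>k = m\<close> \<open>m = n\<close>
    have "((n, \<rho>), (n, \<tau>)) \<in> rep_iso G"
    proof (rule rep_isoI[of "P' * P" _ "Q * Q'"])
      have "P' * P * (Q * Q') = P' * (P * Q) * Q'" "Q * Q' * (P' * P) = Q * (Q' * P') * P"
        using P Q P' Q' by (auto simp: mat_mult_assoc_dim)
      then show "P' * P * (Q * Q') = 1\<^sub>m n" "Q * Q' * (P' * P) = 1\<^sub>m n"
        using P Q P' Q' PQ PQ' by auto
      fix g assume g: "g \<in> carrier G"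
      have d: "\<rho> g \<in> carrier_mat n n" "\<sigma> g \<in> carrier_mat n n" "\<tau> g \<in> carrier_mat n n"
        using repsD(1)[OF is_group r g] repsD(1)[OF is_group s g] repsD(1)[OF is_group t g] by auto
      have "P' * P * \<rho> g = P' * (\<sigma> g * P)" using P P' d by (auto simp: mat_mult_assoc_dim c[OF g])
      also have "\<dots> = (P' * \<sigma> g) * P" using P P' d by (auto simp: mat_mult_assoc_dim)
      also have "\<dots> = \<tau> g * (P' * P)" unfolding c'[OF g] using P P' d by (auto simp: mat_mult_assoc_dim)
      finally show "P' * P * \<rho> g = \<tau> g * (P' * P)" .
    qed (use P Q P' Q' r t in auto)
    then show "(r, t) \<in> rep_iso G" by simp
  qed
qed

lemma (in group) rep_iso_character:
  assumes "(r, s) \<in> rep_iso G" "g \<in> carrier G"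
  shows "character r g = character s g"
proof -
  obtain n \<rho> m \<sigma> where [simp]: "r = (n, \<rho>)" "s = (m, \<sigma>)" by (cases r, cases s)
  from assms(1) obtain P Q where [simp]: "m = n" and P: "P \<in> carrier_mat n n" and Q: "Q \<in> carrier_mat n n"
    and PQ: "P * Q = 1\<^sub>m n" "Q * P = 1\<^sub>m n"
    and c: "\<And>g. g \<in> carrier G \<Longrightarrow> P * \<rho> g = \<sigma> g * P" and r: "(n, \<rho>) \<in> reps G" and s: "(m, \<sigma>) \<in> reps G"
    by (auto elim!: rep_isoE)
  have d: "\<rho> g \<in> carrier_mat n n" "\<sigma> g \<in> carrier_mat n n"
    using repsD(1)[OF is_group r] repsD(1)[OF is_group s] assms(2) by auto
  have "mat_trace (\<sigma> g) = mat_trace (\<sigma> g * (P * Q))" using d by (simp add: PQ)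
  also have "\<sigma> g * (P * Q) = P * \<rho> g * Q" using P Q d by (simp add: c[OF assms(2)] mat_mult_assoc_dim)
  also have "mat_trace \<dots> = mat_trace (Q * (P * \<rho> g))"
    using P Q d by (intro mat_trace_comm[of _ n n]) auto
  also have "Q * (P * \<rho> g) = (Q * P) * \<rho> g" using P Q d by (simp add: mat_mult_assoc_dim)
  finally show ?thesis using d by (simp add: PQ character_def)
qed

text \<open>
  Averaged matrix units are intertwiners. Between representations that are not isomorphic they
  vanish. From an \<open>n\<close>-dimensional representation to itself they are scalars, and taking traces gives
  the scalar \<open>\<bar>G\<bar> / n\<close> for a diagonal unit and \<open>0\<close> otherwise, so the \<open>n\<close> diagonal units add up to \<open>\<bar>G\<bar>\<close>.
\<close>
lemma (in group) character_orthogonality: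
  assumes fin: "finite (carrier G)" and r: "r \<in> irreps G" and s: "s \<in> irreps G"
  shows "(\<Sum>g\<in>carrier G. character s g * character r (inv g)) =
    (if (r, s) \<in> rep_iso G then of_nat (card (carrier G)) else 0)"
proof -
  have norm: "(\<Sum>g\<in>carrier G. character s g * character s (inv g)) = of_nat (card (carrier G))" if s: "s \<in> irreps G" for s
  proof -
    obtain n \<rho> where [simp]: "s = (n, \<rho>)" by (cases s)
    have sr: "(n, \<rho>) \<in> reps G" and n0: "n > 0" using irrepsD[of n \<rho> G] s by auto
    note s' = repsD[OF is_group sr]
    define A where "A i j = mat_sum n n (carrier G) (\<lambda>g. \<rho> g * mat_unit n n i j * \<rho> (inv g))" for i j
    have "A i j $$ (i, j) = (if i = j then of_nat (card (carrier G)) / of_nat n else 0)" if ij: "i < n" "j < n" for i j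
    proof -
      have "A i j * \<rho> h = \<rho> h * A i j" if "h \<in> carrier G" for h
        unfolding A_def by (rule average_intertwines[OF sr sr mat_unit_carrier that])
      then obtain c where c: "A i j = c \<cdot>\<^sub>m 1\<^sub>m n"
        using schur_scalar[OF is_group, of n \<rho> "A i j"] s by (auto simp: A_def)
      have "of_nat n * c = mat_trace (A i j)" by (simp add: c mat_trace_smult_one)
      also have "\<dots> = (\<Sum>g\<in>carrier G. mat_trace (\<rho> g * mat_unit n n i j * \<rho> (inv g)))"
        unfolding A_def by (intro mat_trace_mat_sum mult_carrier_mat[of _ n n] s'(1) mat_unit_carrier) auto
      also have "\<dots> = (\<Sum>g\<in>carrier G. mat_trace (mat_unit n n i j))"
      proof (intro sum.cong refl)
        fix g assume g: "g \<in> carrier G"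
        have "mat_trace (\<rho> g * mat_unit n n i j * \<rho> (inv g)) = mat_trace (\<rho> (inv g) * (\<rho> g * mat_unit n n i j))"
          using s'(1)[OF g] s'(1)[of "inv g"] g by (intro mat_trace_comm[of _ n n]) auto
        also have "\<rho> (inv g) * (\<rho> g * mat_unit n n i j) = mat_unit n n i j"
          using s'(1)[OF g] s'(1)[of "inv g"] s'(5)[OF g] g
            mat_mult_assoc_dim[of "\<rho> (inv g)" "\<rho> g" "mat_unit n n i j"] by (simp add: mat_unit_def)
        finally show "mat_trace (\<rho> g * mat_unit n n i j * \<rho> (inv g)) = mat_trace (mat_unit n n i j)" .
      qed
      also have "\<dots> = of_nat (card (carrier G)) * (if i = j then 1 else 0)"
        using ij by (simp add: mat_trace_def mat_unit_def sum.delta if_distrib cong: if_cong)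
      finally have "c = (if i = j then of_nat (card (carrier G)) / of_nat n else 0)"
        using n0 by (simp add: field_simps split: if_splits)
      then show ?thesis using ij by (simp add: c)
    qed
    then have "(\<Sum>i<n. \<Sum>j<n. A i j $$ (i, j)) = (\<Sum>i<n. \<Sum>j<n. if i = j then of_nat (card (carrier G)) / of_nat n else 0)"
      by (intro sum.cong refl) auto
    also have "\<dots> = of_nat (card (carrier G))" using n0 by (simp add: sum.delta')
    finally show ?thesis using character_sum_expand[OF sr sr] by (simp add: A_def)
  qed
  show ?thesis
  proof (cases "(r, s) \<in> rep_iso G")
    case True
    then have "(\<Sum>g\<in>carrier G. character s g * character r (inv g)) = (\<Sum>g\<in>carrier G. character s g * character s (inv g))"
      by (intro sum.cong refl) (simp add: rep_iso_character)
    then show ?thesis using True norm[OF s] by simp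
  next
    case False
    obtain n \<rho> m \<sigma> where [simp]: "r = (n, \<rho>)" "s = (m, \<sigma>)" by (cases r, cases s)
    have rr: "(n, \<rho>) \<in> reps G" and sr: "(m, \<sigma>) \<in> reps G"
      using r s irrepsD(1)[of n \<rho> G] irrepsD(1)[of m \<sigma> G] by auto
    have "mat_sum m n (carrier G) (\<lambda>g. \<sigma> g * mat_unit m n i j * \<rho> (inv g)) = 0\<^sub>m m n" (is "?A = _") for i j
    proof (rule ccontr)
      assume nz: "?A \<noteq> 0\<^sub>m m n"
      have int: "?A * \<rho> h = \<sigma> h * ?A" if "h \<in> carrier G" for h
        by (rule average_intertwines[OF rr sr mat_unit_carrier that])
      have "invertible_mat ?A"
        using schur_invertible(2)[OF is_group _ _ _ int nz] r s by simp
      then have "(r, s) \<in> rep_iso G"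
        using int rr sr by (auto simp: rep_iso_def intro!: bexI[of _ ?A])
      with False show False by simp
    qed
    then show ?thesis
      using False character_sum_expand[OF rr sr] by simp
  qed
qed

section \<open>Irreducible characters separate class functions\<close>

text \<open>
  The Fourier transform of \<open>f\<close> at \<open>\<rho>\<close>, that is, the action of the group algebra element
  \<open>\<Sum>\<^sub>g f(g) g\<close> in the representation \<open>\<rho>\<close>.
\<close>
definition fourier :: "('a, 'b) monoid_scheme \<Rightarrow> ('a \<Rightarrow> complex) \<Rightarrow> nat \<Rightarrow> ('a \<Rightarrow> complex mat) \<Rightarrow> complex mat" where
  "fourier G f n \<rho> = mat_sum n n (carrier G) (\<lambda>g. f g \<cdot>\<^sub>m \<rho> g)"

lemma fourier_carrier [simp]: "fourier G f n \<rho> \<in> carrier_mat n n"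
  "dim_row (fourier G f n \<rho>) = n" "dim_col (fourier G f n \<rho>) = n"
  by (simp_all add: fourier_def)

lemma (in group) fourier_commutes:
  assumes r: "(n, \<rho>) \<in> reps G" and h: "h \<in> carrier G"
    and cls: "\<And>g h. g \<in> carrier G \<Longrightarrow> h \<in> carrier G \<Longrightarrow> f (h \<otimes> g \<otimes> inv h) = f g"
  shows "fourier G f n \<rho> * \<rho> h = \<rho> h * fourier G f n \<rho>"
proof -
  note r' = repsD[OF is_group r]
  have "\<rho> h * fourier G f n \<rho> = mat_sum n n (carrier G) (\<lambda>g. \<rho> h * (f g \<cdot>\<^sub>m \<rho> g))"
    unfolding fourier_def using r'(1) by (intro mult_mat_sum[OF r'(1)[OF h]]) auto
  also have "\<dots> = mat_sum n n (carrier G) (\<lambda>g. (f g \<cdot>\<^sub>m \<rho> g) * \<rho> h)"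
  proof (rule mat_sum_reindex[OF conj_bij[OF h]])
    fix g assume g: "g \<in> carrier G"
    have "\<rho> (h \<otimes> g \<otimes> inv h) * \<rho> h = \<rho> h * \<rho> g"
      using r'(2)[of "h \<otimes> g \<otimes> inv h" h] r'(2)[of h g] g h by (simp add: m_assoc)
    then show "(f (h \<otimes> g \<otimes> inv h) \<cdot>\<^sub>m \<rho> (h \<otimes> g \<otimes> inv h)) * \<rho> h = \<rho> h * (f g \<cdot>\<^sub>m \<rho> g)"
      using mult_smult_assoc_mat[OF r'(1)[of "h \<otimes> g \<otimes> inv h"] r'(1)[OF h]]
        mult_smult_distrib[OF r'(1)[OF h] r'(1)[OF g]] g h by (simp add: cls)
  qed
  also have "\<dots> = fourier G f n \<rho> * \<rho> h"
    unfolding fourier_def using r'(1) by (intro mat_sum_mult[OF r'(1)[OF h], symmetric]) auto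
  finally show ?thesis by simp
qed

text \<open>
  By Schur's lemma the transform is a scalar matrix, and \<open>orth\<close> says that its trace is \<open>0\<close>.
\<close>
lemma (in group) fourier_irreducible:
  assumes r: "(n, \<rho>) \<in> irreps G"
    and cls: "\<And>g h. g \<in> carrier G \<Longrightarrow> h \<in> carrier G \<Longrightarrow> f (h \<otimes> g \<otimes> inv h) = f g"
    and orth: "(\<Sum>g\<in>carrier G. f g * character (n, \<rho>) g) = 0"
  shows "fourier G f n \<rho> = 0\<^sub>m n n"
proof -
  note rr = irrepsD(1)[OF r]
  note r' = repsD[OF is_group rr]
  obtain c where c: "fourier G f n \<rho> = c \<cdot>\<^sub>m 1\<^sub>m n"
    using schur_scalar[OF is_group r fourier_carrier(1) fourier_commutes[OF rr _ cls]] by blast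
  have "of_nat n * c = mat_trace (fourier G f n \<rho>)" by (simp add: c mat_trace_smult_one)
  also have "\<dots> = (\<Sum>g\<in>carrier G. mat_trace (f g \<cdot>\<^sub>m \<rho> g))"
    unfolding fourier_def using r'(1) by (intro mat_trace_mat_sum) auto
  also have "\<dots> = (\<Sum>g\<in>carrier G. f g * character (n, \<rho>) g)"
  proof (intro sum.cong refl)
    fix g assume "g \<in> carrier G"
    then show "mat_trace (f g \<cdot>\<^sub>m \<rho> g) = f g * character (n, \<rho>) g"
      using r'(1)[of g] by (simp add: mat_trace_def character_def sum_distrib_left)
  qed
  finally have "c = 0" using irrepsD(2)[OF r] by (simp add: orth)
  then show ?thesis by (auto simp: c mat_eq_iff)
qed

definition unitary_reps :: "('a, 'b) monoid_scheme \<Rightarrow> 'a rep set" where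
  "unitary_reps G = {(n, \<rho>) \<in> reps G. \<forall>g \<in> carrier G. mat_adjoint (\<rho> g) = \<rho> (inv\<^bsub>G\<^esub> g)}"

text \<open>
  The restriction of \<open>\<rho>\<close> to the range of \<open>B\<close>, in the orthonormal basis formed by the columns of \<open>B\<close>.
  The range is invariant because the projection \<open>B B\<^sup>*\<close> onto it commutes with \<open>\<rho>\<close>.
\<close>
lemma (in group) compress_unitary_rep:
  assumes r: "(n, \<rho>) \<in> unitary_reps G" and B: "B \<in> carrier_mat n k"
    and iso: "mat_adjoint B * B = 1\<^sub>m k"
    and comm: "\<And>g. g \<in> carrier G \<Longrightarrow> B * mat_adjoint B * \<rho> g = \<rho> g * (B * mat_adjoint B)"
  defines "\<sigma> \<equiv> \<lambda>g. mat_adjoint B * \<rho> g * B"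
  shows "(k, \<sigma>) \<in> unitary_reps G"
    and "fourier G f n \<rho> * B = B * fourier G f k \<sigma>"
proof -
  have rr: "(n, \<rho>) \<in> reps G" and un: "\<And>g. g \<in> carrier G \<Longrightarrow> mat_adjoint (\<rho> g) = \<rho> (inv g)"
    using r by (auto simp: unitary_reps_def)
  note r' = repsD[OF is_group rr]
  note [simp] = carrier_matD[OF B]
  have d [simp]: "dim_row (\<rho> g) = n" "dim_col (\<rho> g) = n" if "g \<in> carrier G" for g
    using r'(1)[OF that] by auto
  have int: "B * \<sigma> g = \<rho> g * B" if g: "g \<in> carrier G" for g
  proof -
    have "B * \<sigma> g = (B * mat_adjoint B * \<rho> g) * B"
      unfolding \<sigma>_def using g by (simp add: mat_mult_assoc_dim)
    also have "\<dots> = \<rho> g * (B * (mat_adjoint B * B))"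
      unfolding comm[OF g] using g by (simp add: mat_mult_assoc_dim)
    finally show ?thesis using B by (simp add: iso)
  qed
  have s1: "\<sigma> g \<in> carrier_mat k k" if "g \<in> carrier G" for g
    using that by (intro carrier_matI) (simp_all add: \<sigma>_def)
  have "(k, \<sigma>) \<in> reps G"
  proof (rule repsI[OF is_group s1])
    fix g h assume g: "g \<in> carrier G" and h: "h \<in> carrier G"
    have "\<sigma> (g \<otimes> h) = mat_adjoint B * \<rho> g * (\<rho> h * B)"
      unfolding \<sigma>_def r'(2)[OF g h] using g h by (simp add: mat_mult_assoc_dim)
    also have "\<dots> = \<sigma> g * \<sigma> h"
      using g h s1[OF h] unfolding int[OF h, symmetric] by (simp add: mat_mult_assoc_dim \<sigma>_def)
    finally show "\<sigma> (g \<otimes> h) = \<sigma> g * \<sigma> h" .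
  next
    show "\<sigma> \<one> = 1\<^sub>m k" using mat_adjoint_carrier[OF B] by (simp add: \<sigma>_def r'(3) iso)
  qed
  moreover have "mat_adjoint (\<sigma> g) = \<sigma> (inv g)" if g: "g \<in> carrier G" for g
    using g by (simp add: \<sigma>_def mat_adjoint_mult mat_mult_assoc_dim un)
  ultimately show "(k, \<sigma>) \<in> unitary_reps G" by (simp add: unitary_reps_def)
  have "fourier G f n \<rho> * B = mat_sum n k (carrier G) (\<lambda>g. (f g \<cdot>\<^sub>m \<rho> g) * B)"
    unfolding fourier_def using r'(1) by (intro mat_sum_mult[OF B]) auto
  also have "\<dots> = mat_sum n k (carrier G) (\<lambda>g. B * (f g \<cdot>\<^sub>m \<sigma> g))"
  proof (rule mat_sum_reindex[of id])
    fix g assume "g \<in> carrier G"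
    then show "B * (f (id g) \<cdot>\<^sub>m \<sigma> (id g)) = f g \<cdot>\<^sub>m \<rho> g * B"
      using mult_smult_distrib[OF B s1] mult_smult_assoc_mat[OF r'(1) B] int by simp
  qed simp
  also have "\<dots> = B * fourier G f k \<sigma>"
    unfolding fourier_def using s1 by (intro mult_mat_sum[OF B, symmetric]) auto
  finally show "fourier G f n \<rho> * B = B * fourier G f k \<sigma>" .
qed

lemma zero_mat_mult_vec: "v \<in> carrier_vec n \<Longrightarrow> 0\<^sub>m m n *\<^sub>v v = (0\<^sub>v m :: complex vec)"
  by (rule eq_vecI) auto

text \<open>
  Orthonormal bases \<open>B\<close> of \<open>W\<close> and \<open>C\<close> of its orthogonal complement, the kernel of \<open>B\<^sup>*\<close>. The
  dimensions add up because \<open>B B\<^sup>*\<close> and \<open>C C\<^sup>*\<close> have traces \<open>k\<close> and \<open>l\<close>.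
\<close>
lemma complement_isometry:
  assumes W: "lin_subspace n W"
  obtains k l B C where "B \<in> carrier_mat n k" "C \<in> carrier_mat n l"
    "mat_adjoint B * B = 1\<^sub>m k" "mat_adjoint C * C = 1\<^sub>m l"
    "B * mat_adjoint B + C * mat_adjoint C = 1\<^sub>m n" "k + l = n"
    "\<And>x. x \<in> carrier_vec k \<Longrightarrow> B *\<^sub>v x \<in> W" "\<And>w. w \<in> W \<Longrightarrow> (B * mat_adjoint B) *\<^sub>v w = w"
proof -
  obtain k B where B: "B \<in> carrier_mat n k" and isoB: "mat_adjoint B * B = 1\<^sub>m k"
    and BW: "\<And>x. x \<in> carrier_vec k \<Longrightarrow> B *\<^sub>v x \<in> W" and BBW: "\<And>w. w \<in> W \<Longrightarrow> (B * mat_adjoint B) *\<^sub>v w = w"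
    by (rule isometry_onto_subspace[OF W]) (erule that; assumption)
  note aB = mat_adjoint_carrier[OF B]
  let ?W' = "{v \<in> carrier_vec n. mat_adjoint B *\<^sub>v v = 0\<^sub>v k}"
  obtain l C where C: "C \<in> carrier_mat n l" and isoC: "mat_adjoint C * C = 1\<^sub>m l"
    and CW: "\<And>x. x \<in> carrier_vec l \<Longrightarrow> C *\<^sub>v x \<in> ?W'" and CCW: "\<And>w. w \<in> ?W' \<Longrightarrow> (C * mat_adjoint C) *\<^sub>v w = w"
    by (rule isometry_onto_subspace[OF kernel_lin_subspace[OF aB]]) (erule that; assumption)
  note aC = mat_adjoint_carrier[OF C]
  have BC: "mat_adjoint B * C = 0\<^sub>m k l"
  proof (rule mat_eq_vecI)
    fix v :: "complex vec" assume v: "v \<in> carrier_vec l"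
    then have "(mat_adjoint B * C) *\<^sub>v v = mat_adjoint B *\<^sub>v (C *\<^sub>v v)"
      using B C by (intro mat_vec_assoc_dim) auto
    then show "(mat_adjoint B * C) *\<^sub>v v = 0\<^sub>m k l *\<^sub>v v" using CW[OF v] v by (auto simp: zero_mat_mult_vec)
  qed (use aB C in auto)
  have "mat_adjoint (mat_adjoint B * C) = mat_adjoint C * B"
    using B C by (simp add: mat_adjoint_mult)
  then have CB: "mat_adjoint C * B = 0\<^sub>m l k"
    unfolding BC by (auto simp: mat_eq_iff)
  let ?P = "B * mat_adjoint B" and ?Q = "C * mat_adjoint C"
  have P: "?P \<in> carrier_mat n n" and Q: "?Q \<in> carrier_mat n n" using B C aB aC by auto
  have one: "?P + ?Q = 1\<^sub>m n"
  proof (rule mat_eq_vecI)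
    fix v :: "complex vec" assume v: "v \<in> carrier_vec n"
    let ?p = "?P *\<^sub>v v"
    let ?u = "v + (-1) \<cdot>\<^sub>v ?p"
    have p: "?p \<in> carrier_vec n" using P v by (rule mult_mat_vec_carrier)
    have "mat_adjoint B *\<^sub>v ?p = (mat_adjoint B * ?P) *\<^sub>v v"
      using B v by (intro mat_vec_assoc_dim[symmetric]) auto
    also have "mat_adjoint B * ?P = (mat_adjoint B * B) * mat_adjoint B"
      using B by (intro mat_mult_assoc_dim[symmetric]) auto
    finally have "mat_adjoint B *\<^sub>v ?p = mat_adjoint B *\<^sub>v v" by (simp only: isoB left_mult_one_mat[OF aB])
    then have "mat_adjoint B *\<^sub>v ?u = mat_adjoint B *\<^sub>v v + (-1) \<cdot>\<^sub>v (mat_adjoint B *\<^sub>v v)"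
      using v p by (simp add: mult_add_distrib_mat_vec[OF aB] mult_mat_vec[OF aB])
    also have "\<dots> = 0\<^sub>v k" using B v by (intro eq_vecI) auto
    finally have Qu: "?Q *\<^sub>v ?u = ?u" using v p by (intro CCW) auto
    have "?Q *\<^sub>v ?p = (?Q * ?P) *\<^sub>v v"
      using B C v by (intro mat_vec_assoc_dim[symmetric]) auto
    also have "?Q * ?P = C * (mat_adjoint C * B) * mat_adjoint B"
      using B C by (simp add: mat_mult_assoc_dim)
    also have "\<dots> = 0\<^sub>m n n" using C by (simp add: CB left_mult_zero_mat[OF aB])
    finally have "?Q *\<^sub>v ?p = 0\<^sub>v n" using v by (simp add: zero_mat_mult_vec)
    moreover have "?Q *\<^sub>v ?u = ?Q *\<^sub>v v + (-1) \<cdot>\<^sub>v (?Q *\<^sub>v ?p)"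
      using v p by (simp add: mult_add_distrib_mat_vec[OF Q] mult_mat_vec[OF Q])
    moreover have "?Q *\<^sub>v v \<in> carrier_vec n" using Q v by (rule mult_mat_vec_carrier)
    moreover have "(-1) \<cdot>\<^sub>v 0\<^sub>v n = (0\<^sub>v n :: complex vec)" by auto
    ultimately have "?Q *\<^sub>v v = ?u" using Qu by (metis right_zero_vec)
    then show "(?P + ?Q) *\<^sub>v v = 1\<^sub>m n *\<^sub>v v"
    proof -
      assume "?Q *\<^sub>v v = ?u"
      moreover have "?p + ?u = v" using v p B by (intro eq_vecI) auto
      ultimately show ?thesis using v by (simp add: add_mult_distrib_mat_vec[OF P Q v])
    qed
  qed (use P Q in auto)
  have "of_nat (k + l) = mat_trace (?P + ?Q)"
  proof -
    have "mat_trace (?P + ?Q) = mat_trace ?P + mat_trace ?Q"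
      using B C by (simp add: mat_trace_def sum.distrib)
    then show ?thesis by (simp add: mat_trace_comm[OF B aB] mat_trace_comm[OF C aC] isoB isoC)
  qed
  then have "k + l = n" unfolding one mat_trace_one of_nat_eq_iff .
  from that[OF B C isoB isoC one this BW BBW] show thesis .
qed

text \<open>
  Induction on the dimension. If \<open>\<rho>\<close> is reducible, it preserves an invariant subspace and, being
  unitary, also the orthogonal complement. The transform vanishes on both by induction, and together
  they span the space.
\<close>
lemma (in group) fourier_unitary:
  assumes cls: "\<And>g h. g \<in> carrier G \<Longrightarrow> h \<in> carrier G \<Longrightarrow> f (h \<otimes> g \<otimes> inv h) = f g"
    and orth: "\<And>r. r \<in> irreps G \<Longrightarrow> (\<Sum>g\<in>carrier G. f g * character r g) = 0"
  shows "(n, \<rho>) \<in> unitary_reps G \<Longrightarrow> fourier G f n \<rho> = 0\<^sub>m n n"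
proof (induction n arbitrary: \<rho> rule: less_induct)
  case (less n)
  have rr: "(n, \<rho>) \<in> reps G" and un: "\<And>g. g \<in> carrier G \<Longrightarrow> mat_adjoint (\<rho> g) = \<rho> (inv g)"
    using less.prems by (auto simp: unitary_reps_def)
  note r' = repsD[OF is_group rr]
  show ?case
  proof (cases "n = 0 \<or> (n, \<rho>) \<in> irreps G")
    case True
    then show ?thesis
      using fourier_irreducible[of n \<rho> f] cls orth by (auto intro!: eq_matI)
  next
    case False
    then have "(n, \<rho>) \<notin> irreps G" "n > 0" by simp_all
    then obtain W where W: "lin_subspace n W" and inv_W: "\<And>g w. g \<in> carrier G \<Longrightarrow> w \<in> W \<Longrightarrow> \<rho> g *\<^sub>v w \<in> W"
      and proper: "W \<noteq> {0\<^sub>v n}" "W \<noteq> carrier_vec n"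
      by (rule not_irrepsE[OF rr]) (assumption | erule that; assumption)+
    obtain k l B C where B: "B \<in> carrier_mat n k" and C: "C \<in> carrier_mat n l"
      and isoB: "mat_adjoint B * B = 1\<^sub>m k" and isoC: "mat_adjoint C * C = 1\<^sub>m l"
      and one: "B * mat_adjoint B + C * mat_adjoint C = 1\<^sub>m n" and kl: "k + l = n"
      and BW: "\<And>x. x \<in> carrier_vec k \<Longrightarrow> B *\<^sub>v x \<in> W" and PW: "\<And>w. w \<in> W \<Longrightarrow> (B * mat_adjoint B) *\<^sub>v w = w"
      by (rule complement_isometry[OF W]) (erule that; assumption)
    note aB = mat_adjoint_carrier[OF B] and aC = mat_adjoint_carrier[OF C]
    define P where "P = B * mat_adjoint B"
    define Q where "Q = C * mat_adjoint C"
    have P: "P \<in> carrier_mat n n" and Q: "Q \<in> carrier_mat n n" using B C aB aC by (auto simp: P_def Q_def)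
    have aP: "mat_adjoint P = P" unfolding P_def using B by (simp add: mat_adjoint_mult)
    have W_sub: "W \<subseteq> carrier_vec n" and W_0: "0\<^sub>v n \<in> W" using W by (auto simp: lin_subspace_def)
    have "k \<noteq> 0"
    proof
      assume "k = 0"
      have "w = 0\<^sub>v n" if "w \<in> W" for w
      proof -
        have "w = B *\<^sub>v (mat_adjoint B *\<^sub>v w)"
          using PW[OF that] mat_vec_assoc_dim[of B "mat_adjoint B" w] B W_sub that by auto
        also have "\<dots> = 0\<^sub>v n" using B \<open>k = 0\<close> by (intro eq_vecI) (auto simp: scalar_prod_def)
        finally show ?thesis .
      qed
      then show False using W_0 proper(1) by blast
    qed
    have "l \<noteq> 0"
    proof
      assume "l = 0"
      then have "Q = 0\<^sub>m n n" using C by (auto simp: Q_def scalar_prod_def intro!: eq_matI)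
      then have "P = 1\<^sub>m n" using one P by (simp add: P_def[symmetric] Q_def[symmetric])
      have "v \<in> W" if "v \<in> carrier_vec n" for v
      proof -
        have "B *\<^sub>v (mat_adjoint B *\<^sub>v v) = P *\<^sub>v v"
          unfolding P_def using B that by (intro mat_vec_assoc_dim[symmetric]) auto
        then show ?thesis using BW[of "mat_adjoint B *\<^sub>v v"] aB that \<open>P = 1\<^sub>m n\<close> by simp
      qed
      then show False using W_sub proper(2) by blast
    qed
    with kl \<open>k \<noteq> 0\<close> have kn: "k < n" "l < n" by auto
    \<comment> \<open>Invariance of \<open>W\<close>, expressed by the projection \<open>P\<close> onto it.\<close>
    have PrP: "P * (\<rho> g * P) = \<rho> g * P" if g: "g \<in> carrier G" for g
    proof (rule mat_eq_vecI)
      fix v :: "complex vec" assume v: "v \<in> carrier_vec n"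
      have Pv: "P *\<^sub>v v \<in> W"
      proof -
        have "P *\<^sub>v v = B *\<^sub>v (mat_adjoint B *\<^sub>v v)"
          unfolding P_def using B v by (intro mat_vec_assoc_dim) auto
        then show ?thesis using BW[of "mat_adjoint B *\<^sub>v v"] aB v by simp
      qed
      have "(\<rho> g * P) *\<^sub>v v = \<rho> g *\<^sub>v (P *\<^sub>v v)"
        using r'(1)[OF g] P v by (intro mat_vec_assoc_dim) auto
      then have "(\<rho> g * P) *\<^sub>v v \<in> W" using inv_W[OF g Pv] by simp
      moreover have "(P * (\<rho> g * P)) *\<^sub>v v = P *\<^sub>v ((\<rho> g * P) *\<^sub>v v)"
        using r'(1)[OF g] P v by (intro mat_vec_assoc_dim) auto
      ultimately show "(P * (\<rho> g * P)) *\<^sub>v v = (\<rho> g * P) *\<^sub>v v" using PW by (simp add: P_def)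
    qed (use r'(1)[OF g] P in auto)
    have commP: "P * \<rho> g = \<rho> g * P" if g: "g \<in> carrier G" for g
    proof -
      have ig: "inv g \<in> carrier G" using g by simp
      \<comment> \<open>The adjoint of the invariance relation for \<open>inv g\<close> is the one with \<open>P\<close> on the other side.\<close>
      have "mat_adjoint (P * (\<rho> (inv g) * P)) = mat_adjoint (\<rho> (inv g) * P)"
        using PrP[OF ig] by simp
      then have "P * \<rho> g * P = P * \<rho> g"
        using P r'(1)[OF ig] r'(1)[OF g] by (simp add: mat_adjoint_mult aP un[OF ig] g)
      moreover have "P * \<rho> g * P = P * (\<rho> g * P)"
        using P r'(1)[OF g] by (intro mat_mult_assoc_dim) auto
      ultimately show ?thesis using PrP[OF g] by simp
    qed
    have commQ: "Q * \<rho> g = \<rho> g * Q" if g: "g \<in> carrier G" for g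
    proof -
      note rg = r'(1)[OF g]
      have "P * \<rho> g + Q * \<rho> g = (P + Q) * \<rho> g" using P Q rg by (intro add_mult_distrib_mat[symmetric]) auto
      also have "\<dots> = \<rho> g * (P + Q)" using one rg by (simp add: P_def Q_def)
      also have "\<dots> = \<rho> g * P + \<rho> g * Q" using P Q rg by (intro mult_add_distrib_mat) auto
      finally have *: "P * \<rho> g + Q * \<rho> g = P * \<rho> g + \<rho> g * Q" by (simp add: commP[OF g])
      show ?thesis
      proof (rule eq_matI)
        fix i j assume "i < dim_row (\<rho> g * Q)" "j < dim_col (\<rho> g * Q)"
        then have "i < n" "j < n" using rg Q by auto
        then show "(Q * \<rho> g) $$ (i, j) = (\<rho> g * Q) $$ (i, j)"
          using arg_cong[OF *, of "\<lambda>M. M $$ (i, j)"] P Q rg by simp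
      qed (use rg Q in auto)
    qed
    define M where "M = fourier G f n \<rho>"
    have M: "M \<in> carrier_mat n n" by (simp add: M_def)
    have MB: "M * B = 0\<^sub>m n k"
    proof -
      note compr = compress_unitary_rep[OF less.prems B isoB]
      have "fourier G f k (\<lambda>g. mat_adjoint B * \<rho> g * B) = 0\<^sub>m k k"
        using commP by (intro less.IH[OF kn(1)] compr(1)) (simp add: P_def)
      then show ?thesis
        using compr(2)[of f] commP by (simp add: P_def M_def right_mult_zero_mat[OF B])
    qed
    have MC: "M * C = 0\<^sub>m n l"
    proof -
      note compr = compress_unitary_rep[OF less.prems C isoC]
      have "fourier G f l (\<lambda>g. mat_adjoint C * \<rho> g * C) = 0\<^sub>m l l"
        using commQ by (intro less.IH[OF kn(2)] compr(1)) (simp add: Q_def)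
      then show ?thesis
        using compr(2)[of f] commQ by (simp add: Q_def M_def right_mult_zero_mat[OF C])
    qed
    have "M = M * (P + Q)" using one M by (simp add: P_def Q_def)
    also have "\<dots> = M * P + M * Q" using M P Q by (intro mult_add_distrib_mat) auto
    also have "M * P = M * B * mat_adjoint B" using M B by (simp add: P_def mat_mult_assoc_dim)
    also have "M * Q = M * C * mat_adjoint C" using M C by (simp add: Q_def mat_mult_assoc_dim)
    finally have "M = 0\<^sub>m n n"
      unfolding MB MC left_mult_zero_mat[OF aB] left_mult_zero_mat[OF aC] by simp
    then show ?thesis by (simp add: M_def)
  qed
qed

text \<open>
  The regular representation, by permutation matrices with respect to an enumeration \<open>e\<close> of the group.
\<close>
lemma (in group) regular_rep:
  assumes e: "bij_betw e {..<N} (carrier G)"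
  defines "R \<equiv> \<lambda>g. mat N N (\<lambda>(i, j). if g \<otimes> e j = e i then 1 else (0 :: complex))"
  shows "(N, R) \<in> unitary_reps G"
proof -
  have e_in: "e i \<in> carrier G" if "i < N" for i using e that by (auto simp: bij_betw_def)
  have e_inj: "e i = e j \<longleftrightarrow> i = j" if "i < N" "j < N" for i j
    using e that by (auto simp: bij_betw_def inj_on_def)
  have fin: "finite (carrier G)" using e bij_betw_finite by blast
  have "(N, R) \<in> reps G"
  proof (rule repsI[OF is_group])
    fix g h assume g: "g \<in> carrier G" and h: "h \<in> carrier G"
    show "R (g \<otimes> h) = R g * R h"
    proof (rule eq_matI)
      fix i j assume "i < dim_row (R g * R h)" "j < dim_col (R g * R h)"
      then have ij: "i < N" "j < N" by (auto simp: R_def)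
      have "(R g * R h) $$ (i, j) = (\<Sum>l<N. (if g \<otimes> e l = e i then 1 else 0) * (if h \<otimes> e j = e l then 1 else 0))"
        using ij by (simp add: R_def scalar_prod_def lessThan_atLeast0)
      also have "\<dots> = (\<Sum>x\<in>carrier G. (if g \<otimes> x = e i then 1 else 0) * (if h \<otimes> e j = x then 1 else 0))"
        by (rule sum.reindex_bij_betw[OF e])
      also have "\<dots> = (\<Sum>x\<in>carrier G. if x = h \<otimes> e j then (if g \<otimes> (h \<otimes> e j) = e i then 1 else 0) else 0)"
        by (intro sum.cong) auto
      also have "\<dots> = (if g \<otimes> h \<otimes> e j = e i then 1 else 0)"
        using g h e_in[OF ij(2)] fin by (simp add: sum.delta m_assoc)
      finally show "R (g \<otimes> h) $$ (i, j) = (R g * R h) $$ (i, j)" using ij by (simp add: R_def)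
    qed (simp_all add: R_def)
  next
    show "R \<one> = 1\<^sub>m N" by (rule eq_matI) (auto simp: R_def e_in e_inj)
  qed (simp add: R_def)
  moreover have "mat_adjoint (R g) = R (inv g)" if g: "g \<in> carrier G" for g
  proof (rule eq_matI)
    fix i j assume "i < dim_row (R (inv g))" "j < dim_col (R (inv g))"
    then have ij: "i < N" "j < N" by (auto simp: R_def)
    have "g \<otimes> e i = e j \<longleftrightarrow> inv g \<otimes> e j = e i"
      using g e_in[OF ij(1)] e_in[OF ij(2)] inv_solve_left'[of "e i" g "e j"] by auto
    then show "mat_adjoint (R g) $$ (i, j) = R (inv g) $$ (i, j)" using ij by (simp add: R_def)
  qed (simp_all add: R_def)
  ultimately show ?thesis by (simp add: unitary_reps_def)
qed

text \<open>
  The transform of \<open>f\<close> at the regular representation is \<open>0\<close>, and its column at the neutral element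
  lists the values of \<open>f\<close>.
\<close>
lemma (in group) class_function_eq_0:
  assumes fin: "finite (carrier G)"
    and cls: "\<And>g h. g \<in> carrier G \<Longrightarrow> h \<in> carrier G \<Longrightarrow> f (h \<otimes> g \<otimes> inv h) = f g"
    and orth: "\<And>r. r \<in> irreps G \<Longrightarrow> (\<Sum>g\<in>carrier G. f g * character r g) = 0"
    and x: "x \<in> carrier G"
  shows "f x = 0"
proof -
  define N where "N = card (carrier G)"
  obtain e where e: "bij_betw e {..<N} (carrier G)"
    using ex_bij_betw_nat_finite[OF fin] by (auto simp: N_def lessThan_atLeast0)
  define R where "R = (\<lambda>g. mat N N (\<lambda>(i, j). if g \<otimes> e j = e i then 1 else (0 :: complex)))"
  obtain i j where ij: "i < N" "e i = x" "j < N" "e j = \<one>"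
    using e x one_closed unfolding bij_betw_def by (metis imageE lessThan_iff)
  have "fourier G f N R = 0\<^sub>m N N"
    using fourier_unitary[OF cls orth] regular_rep[OF e] by (simp add: R_def)
  then have "0 = fourier G f N R $$ (i, j)" using ij by simp
  also have "\<dots> = (\<Sum>g\<in>carrier G. if g = x then f x else 0)"
    using ij by (auto simp: fourier_def R_def intro!: sum.cong)
  also have "\<dots> = f x" using fin x by simp
  finally show ?thesis by simp
qed

section \<open>Column orthogonality\<close>

definition irr_rep :: "('a, 'b) monoid_scheme \<Rightarrow> 'a rep set \<Rightarrow> 'a rep" where
  "irr_rep G X = (SOME r. r \<in> irreps G \<and> X = rep_iso G `` {r})"

abbreviation irr_char :: "('a, 'b) monoid_scheme \<Rightarrow> 'a rep set \<Rightarrow> 'a \<Rightarrow> complex" where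
  "irr_char G X \<equiv> character (irr_rep G X)"

abbreviation conj_action :: "('a, 'b) monoid_scheme \<Rightarrow> 'a \<Rightarrow> 'a \<Rightarrow> 'a" where
  "conj_action G \<equiv> \<lambda>g. \<lambda>h \<in> carrier G. g \<otimes>\<^bsub>G\<^esub> h \<otimes>\<^bsub>G\<^esub> inv\<^bsub>G\<^esub> g"

lemma irreps_subset_reps: "irreps G \<subseteq> reps G"
  by (auto simp: irreps_def)

lemma irr_rep:
  assumes "X \<in> Irr G"
  shows "irr_rep G X \<in> irreps G" "X = rep_iso G `` {irr_rep G X}"
proof -
  from assms obtain r where "r \<in> irreps G \<and> X = rep_iso G `` {r}"
    unfolding Irr_def by (auto elim: quotientE)
  then have "irr_rep G X \<in> irreps G \<and> X = rep_iso G `` {irr_rep G X}"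
    unfolding irr_rep_def by (rule someI)
  then show "irr_rep G X \<in> irreps G" "X = rep_iso G `` {irr_rep G X}" by blast+
qed

lemma (in group) irr_rep_iso_iff:
  assumes "X \<in> Irr G" "r \<in> irreps G"
  shows "(irr_rep G X, r) \<in> rep_iso G \<longleftrightarrow> X = rep_iso G `` {r}"
proof -
  have "irr_rep G X \<in> reps G" "r \<in> reps G"
    using irr_rep(1)[OF assms(1)] assms(2) irreps_subset_reps by blast+
  from eq_equiv_class_iff[OF rep_iso_equiv this] show ?thesis
    unfolding irr_rep(2)[OF assms(1), symmetric] by blast
qed

lemma (in group) irr_char_orthogonality:
  assumes fin: "finite (carrier G)" and "X \<in> Irr G" "Y \<in> Irr G"
  shows "(\<Sum>g\<in>carrier G. irr_char G Y g * irr_char G X (inv g)) =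
    (if X = Y then of_nat (card (carrier G)) else 0)"
  using character_orthogonality[OF fin irr_rep(1)[OF assms(2)] irr_rep(1)[OF assms(3)]]
  unfolding irr_rep_iso_iff[OF assms(2) irr_rep(1)[OF assms(3)]]
    irr_rep(2)[OF assms(3), symmetric] .

text \<open>
  By orthogonality, the table of \<open>m\<close> distinct irreducible characters, an \<open>m \<times> \<bar>G\<bar>\<close> matrix, has a right
  inverse, so \<open>m \<le> \<bar>G\<bar>\<close>.
\<close>
lemma (in group) finite_Irr:
  assumes fin: "finite (carrier G)"
  shows "finite (Irr G)"
proof -
  let ?N = "card (carrier G)"
  obtain e where e: "bij_betw e {..<?N} (carrier G)"
    using ex_bij_betw_nat_finite[OF fin] by (auto simp: lessThan_atLeast0)
  have N0: "?N > 0" using fin one_closed by (auto simp: card_gt_0_iff)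
  have "card F \<le> ?N" if F: "F \<subseteq> Irr G" "finite F" for F
  proof -
    obtain x where x: "bij_betw x {..<card F} F"
      using ex_bij_betw_nat_finite[OF F(2)] by (auto simp: lessThan_atLeast0)
    have xI: "x i \<in> Irr G" if "i < card F" for i using x that F(1) by (auto simp: bij_betw_def)
    have x_inj: "x i = x j \<longleftrightarrow> i = j" if "i < card F" "j < card F" for i j
      using x that by (auto simp: bij_betw_def inj_on_def)
    define A where "A = mat (card F) ?N (\<lambda>(i, j). irr_char G (x i) (e j) / of_nat ?N)"
    define B where "B = mat ?N (card F) (\<lambda>(j, i). irr_char G (x i) (inv (e j)))"
    have "A * B = 1\<^sub>m (card F)"
    proof (rule eq_matI)
      fix i j assume "i < dim_row (1\<^sub>m (card F) :: complex mat)" "j < dim_col (1\<^sub>m (card F) :: complex mat)"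
      then have i: "i < card F" and j: "j < card F" by auto
      have "(A * B) $$ (i, j) = (\<Sum>l<?N. irr_char G (x i) (e l) * irr_char G (x j) (inv (e l))) / of_nat ?N"
        using i j by (simp add: A_def B_def scalar_prod_def lessThan_atLeast0 sum_divide_distrib)
      also have "(\<Sum>l<?N. irr_char G (x i) (e l) * irr_char G (x j) (inv (e l))) =
          (\<Sum>g\<in>carrier G. irr_char G (x i) g * irr_char G (x j) (inv g))"
        by (rule sum.reindex_bij_betw[OF e])
      finally show "(A * B) $$ (i, j) = 1\<^sub>m (card F) $$ (i, j)"
        using N0 i j by (simp add: irr_char_orthogonality[OF fin xI[OF j] xI[OF i]] x_inj)
    qed (simp_all add: A_def B_def)
    then show ?thesis
      by (rule left_inverse_dim_le[rotated 2]) (simp_all add: A_def B_def)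
  qed
  then show ?thesis using finite_if_finite_subsets_card_bdd by blast
qed

lemma (in group) character_conj:
  assumes r: "r \<in> reps G" and g: "g \<in> carrier G" and h: "h \<in> carrier G"
  shows "character r (h \<otimes> g \<otimes> inv h) = character r g"
proof -
  obtain n \<rho> where [simp]: "r = (n, \<rho>)" by (cases r)
  have rr: "(n, \<rho>) \<in> reps G" using r by simp
  note r' = repsD[OF is_group rr]
  have d: "\<rho> g \<in> carrier_mat n n" "\<rho> h \<in> carrier_mat n n" "\<rho> (inv h) \<in> carrier_mat n n"
    using r'(1) g h by auto
  have "\<rho> (h \<otimes> g \<otimes> inv h) = \<rho> h * \<rho> g * \<rho> (inv h)" using r'(2) g h by simp
  then have "mat_trace (\<rho> (h \<otimes> g \<otimes> inv h)) = mat_trace (\<rho> (inv h) * (\<rho> h * \<rho> g))"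
    using d mat_trace_comm[of "\<rho> h * \<rho> g" n n "\<rho> (inv h)"] by simp
  also have "\<rho> (inv h) * (\<rho> h * \<rho> g) = \<rho> (inv h) * \<rho> h * \<rho> g"
    using d by (intro mat_mult_assoc_dim[symmetric]) auto
  finally show ?thesis using d r'(5)[OF h] by (simp add: character_def)
qed

text \<open>
  The class function \<open>f1\<close> counts the \<open>k\<close> that conjugate \<open>h\<close> into a given element, and \<open>f2\<close> is its
  expansion in irreducible characters. Their difference is orthogonal to all irreducible characters,
  so it is \<open>0\<close>; the claim is the value at \<open>h\<close>.
\<close>
lemma (in group) column_orthogonality:
  assumes fin: "finite (carrier G)" and h: "h \<in> carrier G"
  shows "(\<Sum>X\<in>Irr G. irr_char G X h * irr_char G X (inv h)) =
    of_nat (card (stabilizer G (conj_action G) h))"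
proof -
  let ?N = "of_nat (card (carrier G)) :: complex"
  have reps: "irr_rep G X \<in> reps G" if "X \<in> Irr G" for X
    using irr_rep(1)[OF that] irreps_subset_reps by blast
  define f1 where "f1 g = (\<Sum>k\<in>carrier G. if k \<otimes> h \<otimes> inv k = g then 1 else 0 :: complex)" for g
  define f2 where "f2 g = (\<Sum>X\<in>Irr G. irr_char G X h * irr_char G X (inv g))" for g
  have cls1: "f1 (u \<otimes> g \<otimes> inv u) = f1 g" if g: "g \<in> carrier G" and u: "u \<in> carrier G" for g u
  proof -
    have "u \<otimes> k \<otimes> h \<otimes> inv (u \<otimes> k) = u \<otimes> g \<otimes> inv u \<longleftrightarrow> k \<otimes> h \<otimes> inv k = g" if k: "k \<in> carrier G" for k
    proof -
      have "u \<otimes> k \<otimes> h \<otimes> inv (u \<otimes> k) = u \<otimes> (k \<otimes> h \<otimes> inv k) \<otimes> inv u"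
        using u k h by (simp add: inv_mult_group m_assoc)
      then show ?thesis using u k h g by simp
    qed
    then have "f1 g = (\<Sum>k\<in>carrier G. if u \<otimes> k \<otimes> h \<otimes> inv (u \<otimes> k) = u \<otimes> g \<otimes> inv u then 1 else 0)"
      unfolding f1_def by (intro sum.cong) auto
    also have "\<dots> = f1 (u \<otimes> g \<otimes> inv u)"
      unfolding f1_def by (rule sum.reindex_bij_betw[OF left_mult_bij[OF u]])
    finally show ?thesis by simp
  qed
  have cls2: "f2 (u \<otimes> g \<otimes> inv u) = f2 g" if g: "g \<in> carrier G" and u: "u \<in> carrier G" for g u
  proof -
    have "inv (u \<otimes> g \<otimes> inv u) = u \<otimes> inv g \<otimes> inv u" using g u by (simp add: inv_mult_group m_assoc)
    then show ?thesis unfolding f2_def using g u by (intro sum.cong refl) (simp add: character_conj reps)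
  qed
  have "f1 h - f2 h = 0"
  proof (rule class_function_eq_0[OF fin _ _ h, of "\<lambda>g. f1 g - f2 g"])
    fix r assume r: "r \<in> irreps G"
    then have rr: "r \<in> reps G" using irreps_subset_reps by blast
    have "(\<Sum>g\<in>carrier G. f1 g * character r g) =
        (\<Sum>k\<in>carrier G. \<Sum>g\<in>carrier G. if g = k \<otimes> h \<otimes> inv k then character r g else 0)"
      unfolding f1_def sum_distrib_right by (subst sum.swap) (intro sum.cong refl, auto)
    also have "\<dots> = ?N * character r h"
      using fin h by (simp add: sum.delta character_conj[OF rr])
    finally have 1: "(\<Sum>g\<in>carrier G. f1 g * character r g) = ?N * character r h" .
    let ?X = "rep_iso G `` {r}"
    have X: "?X \<in> Irr G" using r by (auto simp: Irr_def quotient_def)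
    have "(\<Sum>g\<in>carrier G. f2 g * character r g) =
        (\<Sum>X\<in>Irr G. irr_char G X h * (\<Sum>g\<in>carrier G. character r g * irr_char G X (inv g)))"
      unfolding f2_def sum_distrib_right sum_distrib_left
      by (subst sum.swap) (intro sum.cong refl, simp)
    also have "\<dots> = (\<Sum>X\<in>Irr G. if X = ?X then irr_char G X h * ?N else 0)"
      by (intro sum.cong refl) (simp add: character_orthogonality[OF fin irr_rep(1) r] irr_rep_iso_iff r)
    also have "\<dots> = irr_char G ?X h * ?N" using X finite_Irr[OF fin] by simp
    also have "irr_char G ?X h = character r h"
      using rep_iso_character[of "irr_rep G ?X" r h] irr_rep_iso_iff[OF X r] h by simp
    finally show "(\<Sum>g\<in>carrier G. (f1 g - f2 g) * character r g) = 0"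
      using 1 by (simp add: left_diff_distrib sum_subtractf)
  qed (simp add: cls1 cls2)
  moreover have "f1 h = of_nat (card (stabilizer G (conj_action G) h))"
  proof -
    have "stabilizer G (conj_action G) h = {k \<in> carrier G. k \<otimes> h \<otimes> inv k = h}"
      using h by (auto simp: stabilizer_def)
    then show ?thesis
      unfolding f1_def using fin by (simp add: sum.If_cases Int_def)
  qed
  ultimately show ?thesis by (simp add: f2_def)
qed

section \<open>Representations fixed by the sign twist\<close>

lemma sign_homD:
  assumes "\<epsilon> \<in> hom G sign_img"
  shows "g \<in> carrier G \<Longrightarrow> \<epsilon> g * \<epsilon> g = (1 :: int)"
    "g \<in> carrier G \<Longrightarrow> h \<in> carrier G \<Longrightarrow> \<epsilon> (g \<otimes>\<^bsub>G\<^esub> h) = \<epsilon> g * \<epsilon> h"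
  using assms by (auto simp: hom_def sign_img_def Pi_def)

lemma (in group) sign_hom_one: "\<epsilon> \<in> hom G sign_img \<Longrightarrow> \<epsilon> \<one> = 1"
  using sign_homD[of \<epsilon> G \<one>] sign_homD(2)[of \<epsilon> G \<one> \<one>] by simp

lemma kronecker_1x1: "kronecker A (mat 1 1 (\<lambda>_. c)) = c \<cdot>\<^sub>m A"
  by (rule eq_matI) (auto simp: kronecker_def)

lemma twist_eq: "twist \<epsilon> (n, \<rho>) = (n, \<lambda>g. of_int (\<epsilon> g) \<cdot>\<^sub>m \<rho> g)"
  unfolding twist_def tensor_rep_def one_dim_rep_def fst_conv snd_conv kronecker_1x1 by simp

lemma (in group) twist_reps:
  assumes e: "\<epsilon> \<in> hom G sign_img" and r: "r \<in> reps G"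
  shows "twist \<epsilon> r \<in> reps G"
proof -
  obtain n \<rho> where [simp]: "r = (n, \<rho>)" by (cases r)
  have rr: "(n, \<rho>) \<in> reps G" using r by simp
  note r' = repsD[OF is_group rr]
  have "\<epsilon> \<one> = 1" by (rule sign_hom_one[OF e])
  then have "(n, \<lambda>g. of_int (\<epsilon> g) \<cdot>\<^sub>m \<rho> g) \<in> reps G"
  proof (intro repsI[OF is_group])
    fix g h assume g: "g \<in> carrier G" and h: "h \<in> carrier G"
    then show "of_int (\<epsilon> (g \<otimes> h)) \<cdot>\<^sub>m \<rho> (g \<otimes> h) = of_int (\<epsilon> g) \<cdot>\<^sub>m \<rho> g * (of_int (\<epsilon> h) \<cdot>\<^sub>m \<rho> h)"
      using r'(1)[OF g] r'(1)[OF h] r'(2)[OF g h]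
      by (simp add: sign_homD(2)[OF e] mult_smult_assoc_mat[of _ n n] mult_smult_distrib[of _ n n])
        (auto simp: mat_eq_iff)
  next
    show "of_int (\<epsilon> \<one>) \<cdot>\<^sub>m \<rho> \<one> = 1\<^sub>m n" using \<open>\<epsilon> \<one> = 1\<close> r'(3) by auto
  qed (use r'(1) in auto)
  then show ?thesis by (simp add: twist_eq)
qed

text \<open>
  As \<open>\<epsilon>(g) = \<plusminus>1\<close>, the representation and its twist have the same invariant subspaces.
\<close>
lemma (in group) twist_irreps:
  assumes e: "\<epsilon> \<in> hom G sign_img" and r: "r \<in> irreps G"
  shows "twist \<epsilon> r \<in> irreps G"
proof -
  obtain n \<rho> where [simp]: "r = (n, \<rho>)" by (cases r)
  have ri: "(n, \<rho>) \<in> irreps G" using r by simp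
  note r' = repsD[OF is_group irrepsD(1)[OF ri]]
  have tr: "(n, \<lambda>g. of_int (\<epsilon> g) \<cdot>\<^sub>m \<rho> g) \<in> reps G"
    using twist_reps[OF e irrepsD(1)[OF ri]] by (simp add: twist_eq)
  have "(n, \<lambda>g. of_int (\<epsilon> g) \<cdot>\<^sub>m \<rho> g) \<in> irreps G"
  proof (rule ccontr)
    assume "\<not> ?thesis"
    then show False
    proof (rule not_irrepsE[OF tr _ irrepsD(2)[OF ri]])
      fix W assume W: "lin_subspace n W" "W \<noteq> {0\<^sub>v n}" "W \<noteq> carrier_vec n"
        and inv_W: "\<And>g w. g \<in> carrier G \<Longrightarrow> w \<in> W \<Longrightarrow> (of_int (\<epsilon> g) \<cdot>\<^sub>m \<rho> g) *\<^sub>v w \<in> W"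
      have "\<rho> g *\<^sub>v w \<in> W" if g: "g \<in> carrier G" and w: "w \<in> W" for g w
      proof -
        have wn: "w \<in> carrier_vec n" using w W(1) by (auto simp: lin_subspace_def)
        have "of_int (\<epsilon> g) \<cdot>\<^sub>v ((of_int (\<epsilon> g) \<cdot>\<^sub>m \<rho> g) *\<^sub>v w) \<in> W"
          using inv_W[OF g w] W(1) by (auto simp: lin_subspace_def)
        moreover have "of_int (\<epsilon> g) \<cdot>\<^sub>v ((of_int (\<epsilon> g) \<cdot>\<^sub>m \<rho> g) *\<^sub>v w) = \<rho> g *\<^sub>v w"
          using r'(1)[OF g] wn
          by (simp add: smult_mat_mult_vec smult_smult_assoc of_int_mult[symmetric] sign_homD(1)[OF e g] del: of_int_mult)
        ultimately show ?thesis by simp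
      qed
      with irrepsD(3)[OF ri W(1)] W(2,3) show False by blast
    qed
  qed
  then show ?thesis by (simp add: twist_eq)
qed

lemma (in group) twist_character:
  assumes "r \<in> reps G" "g \<in> carrier G"
  shows "character (twist \<epsilon> r) g = of_int (\<epsilon> g) * character r g"
proof -
  obtain n \<rho> where [simp]: "r = (n, \<rho>)" by (cases r)
  show ?thesis
    using repsD(1)[OF is_group, of n \<rho> g] assms
    by (simp add: twist_eq character_def mat_trace_def sum_distrib_left)
qed

lemma (in group) twist_rep_iso:
  assumes e: "\<epsilon> \<in> hom G sign_img" and rs: "(r, s) \<in> rep_iso G"
  shows "(twist \<epsilon> r, twist \<epsilon> s) \<in> rep_iso G"
proof -
  obtain n \<rho> m \<sigma> where [simp]: "r = (n, \<rho>)" "s = (m, \<sigma>)" by (cases r, cases s)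
  from rs obtain P Q where [simp]: "m = n" and P: "P \<in> carrier_mat n n" and Q: "Q \<in> carrier_mat n n"
    and PQ: "P * Q = 1\<^sub>m n" "Q * P = 1\<^sub>m n"
    and c: "\<And>g. g \<in> carrier G \<Longrightarrow> P * \<rho> g = \<sigma> g * P" and r: "(n, \<rho>) \<in> reps G" and s: "(m, \<sigma>) \<in> reps G"
    by (auto elim!: rep_isoE)
  have "((n, \<lambda>g. of_int (\<epsilon> g) \<cdot>\<^sub>m \<rho> g), (n, \<lambda>g. of_int (\<epsilon> g) \<cdot>\<^sub>m \<sigma> g)) \<in> rep_iso G"
  proof (rule rep_isoI[OF P Q PQ])
    fix g assume g: "g \<in> carrier G"
    then show "P * (of_int (\<epsilon> g) \<cdot>\<^sub>m \<rho> g) = of_int (\<epsilon> g) \<cdot>\<^sub>m \<sigma> g * P"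
      using repsD(1)[OF is_group r g] repsD(1)[OF is_group s g] P c[OF g]
      by (simp add: mult_smult_assoc_mat[of _ n n] mult_smult_distrib[of _ n n])
  qed (use twist_reps[OF e r] twist_reps[OF e s] in \<open>simp_all add: twist_eq\<close>)
  then show ?thesis by (simp add: twist_eq)
qed

text \<open>
  By the orbit-stabilizer theorem the centralizers of the elements of one conjugacy class have
  altogether \<open>\<bar>G\<bar>\<close> elements, and \<open>\<epsilon>\<close> is constant on the class.
\<close>
lemma (in group) sum_sign_stabilizer:
  assumes e: "\<epsilon> \<in> hom G sign_img" and fin: "finite (carrier G)"
  shows "(\<Sum>g\<in>carrier G. \<epsilon> g * int (card (stabilizer G (conj_action G) g))) =
    (\<Sum>c\<in>conj_classes G. class_value \<epsilon> c) * int (card (carrier G))"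
proof -
  interpret conj: group_action G "carrier G" "conj_action G"
    by (rule action_by_conjugation)
  have "(\<Sum>g\<in>carrier G. \<epsilon> g * int (card (stabilizer G (conj_action G) g))) =
      (\<Sum>c\<in>conj_classes G. \<Sum>g\<in>c. \<epsilon> g * int (card (stabilizer G (conj_action G) g)))"
    unfolding conj_classes_def by (rule conj.disjoint_sum[OF fin, symmetric])
  also have "\<dots> = (\<Sum>c\<in>conj_classes G. class_value \<epsilon> c * int (card (carrier G)))"
  proof (intro sum.cong refl)
    fix c assume c: "c \<in> conj_classes G"
    then obtain h where h: "h \<in> carrier G" and ch: "c = Group_Action.orbit G (conj_action G) h"
      by (auto simp: conj_classes_def Group_Action.orbits_def)
    have const: "\<epsilon> g = \<epsilon> h" if g: "g \<in> c" for g
    proof -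
      obtain k where k: "k \<in> carrier G" "g = k \<otimes> h \<otimes> inv k"
        using g h by (auto simp: ch Group_Action.orbit_def)
      have "\<epsilon> k * \<epsilon> (inv k) = 1"
        using sign_homD(2)[OF e k(1), of "inv k"] k sign_hom_one[OF e] by simp
      then show ?thesis using k h by (simp add: sign_homD(2)[OF e] mult.commute mult.left_commute)
    qed
    have "h \<in> c" unfolding ch using conj.orbit_refl[OF h] .
    have "\<epsilon> ` c = (\<lambda>_. \<epsilon> h) ` c" by (rule image_cong[OF refl const])
    also have "\<dots> = {\<epsilon> h}" using \<open>h \<in> c\<close> by blast
    finally have "\<epsilon> ` c = {\<epsilon> h}" .
    then have val: "class_value \<epsilon> c = \<epsilon> h" by (simp add: class_value_def)
    have "(\<Sum>g\<in>c. \<epsilon> g * int (card (stabilizer G (conj_action G) g))) =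
        \<epsilon> h * int (\<Sum>g\<in>c. card (stabilizer G (conj_action G) g))"
      unfolding of_nat_sum sum_distrib_left by (intro sum.cong refl) (simp only: const)
    also have "(\<Sum>g\<in>c. card (stabilizer G (conj_action G) g)) = card (carrier G)"
      using conj.card_stablizer_sum[OF fin] c by (simp add: conj_classes_def Coset.order_def)
    finally show "(\<Sum>g\<in>c. \<epsilon> g * int (card (stabilizer G (conj_action G) g))) =
        class_value \<epsilon> c * int (card (carrier G))" unfolding val .
  qed
  finally show ?thesis by (simp add: sum_distrib_right)
qed

text \<open>
  Both sides, multiplied by \<open>\<bar>G\<bar>\<close>, are the double sum of \<open>\<epsilon>(g) \<chi>(g) \<chi>(inv g)\<close> over \<open>g\<close> and \<open>\<chi>\<close>: the left
  one by row orthogonality between \<open>\<chi>\<close> and its twist, the right one by column orthogonality.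
\<close>
theorem (in group) card_twist_fixed:
  assumes e: "\<epsilon> \<in> hom G sign_img" and fin: "finite (carrier G)"
  shows "int (card {X \<in> Irr G. \<forall>r \<in> X. (twist \<epsilon> r, r) \<in> rep_iso G}) =
    (\<Sum>c \<in> conj_classes G. class_value \<epsilon> c)"
proof -
  let ?F = "{X \<in> Irr G. \<forall>r \<in> X. (twist \<epsilon> r, r) \<in> rep_iso G}"
  let ?N = "card (carrier G)"
  have N0: "?N > 0" using fin one_closed by (auto simp: card_gt_0_iff)
  \<comment> \<open>Twisting respects isomorphism, so it suffices to test one member of the class.\<close>
  have fixed_iff: "X \<in> ?F \<longleftrightarrow> (twist \<epsilon> (irr_rep G X), irr_rep G X) \<in> rep_iso G" if X: "X \<in> Irr G" for X
  proof
    have "irr_rep G X \<in> X"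
      using irr_rep[OF X] irreps_subset_reps[of G] equiv_class_self[OF rep_iso_equiv] by blast
    then show "X \<in> ?F \<Longrightarrow> (twist \<epsilon> (irr_rep G X), irr_rep G X) \<in> rep_iso G" by simp
  next
    assume fix0: "(twist \<epsilon> (irr_rep G X), irr_rep G X) \<in> rep_iso G"
    have "(twist \<epsilon> r, r) \<in> rep_iso G" if "r \<in> X" for r
    proof -
      have 1: "(irr_rep G X, r) \<in> rep_iso G" using that irr_rep(2)[OF X] by blast
      have 2: "(twist \<epsilon> r, twist \<epsilon> (irr_rep G X)) \<in> rep_iso G"
        using twist_rep_iso[OF e 1] rep_iso_equiv by (meson equivE symD)
      show ?thesis using 1 2 fix0 rep_iso_equiv by (meson equivE transD)
    qed
    then show "X \<in> ?F" using X by simp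
  qed
  have norm: "(\<Sum>g\<in>carrier G. of_int (\<epsilon> g) * (irr_char G X g * irr_char G X (inv g))) =
      (if X \<in> ?F then of_nat ?N else 0)" if X: "X \<in> Irr G" for X
  proof -
    let ?r = "irr_rep G X"
    have ri: "?r \<in> irreps G" and rr: "?r \<in> reps G"
      using irr_rep(1)[OF X] irreps_subset_reps by blast+
    have "(\<Sum>g\<in>carrier G. of_int (\<epsilon> g) * (irr_char G X g * irr_char G X (inv g))) =
        (\<Sum>g\<in>carrier G. character (twist \<epsilon> ?r) g * character ?r (inv g))"
      by (intro sum.cong refl) (simp add: twist_character[OF rr])
    also have "\<dots> = (if (?r, twist \<epsilon> ?r) \<in> rep_iso G then of_nat ?N else 0)"
      by (rule character_orthogonality[OF fin ri twist_irreps[OF e ri]])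
    also have "(?r, twist \<epsilon> ?r) \<in> rep_iso G \<longleftrightarrow> (twist \<epsilon> ?r, ?r) \<in> rep_iso G"
      using rep_iso_equiv by (meson equivE symD)
    finally show ?thesis using fixed_iff[OF X] by simp
  qed
  have "complex_of_int (int (card ?F) * int ?N) = (\<Sum>X\<in>Irr G. if X \<in> ?F then of_nat ?N else 0)"
    using finite_Irr[OF fin] by (simp add: sum.If_cases Int_def)
  also have "\<dots> = (\<Sum>X\<in>Irr G. \<Sum>g\<in>carrier G. of_int (\<epsilon> g) * (irr_char G X g * irr_char G X (inv g)))"
    by (intro sum.cong refl) (simp only: norm)
  also have "\<dots> = (\<Sum>g\<in>carrier G. of_int (\<epsilon> g) * (\<Sum>X\<in>Irr G. irr_char G X g * irr_char G X (inv g)))"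
    by (subst sum.swap) (simp add: sum_distrib_left)
  also have "\<dots> = (\<Sum>g\<in>carrier G. of_int (\<epsilon> g) * of_nat (card (stabilizer G (conj_action G) g)))"
    by (intro sum.cong refl) (simp only: column_orthogonality[OF fin])
  also have "\<dots> = of_int (\<Sum>g\<in>carrier G. \<epsilon> g * int (card (stabilizer G (conj_action G) g)))"
    by simp
  finally have "int (card ?F) * int ?N = (\<Sum>c\<in>conj_classes G. class_value \<epsilon> c) * int ?N"
    unfolding of_int_eq_iff sum_sign_stabilizer[OF e fin] .
  then show ?thesis using N0 by simp
qed

section \<open>Signs of the permutations of a given cycle type\<close>

text \<open>
  The \<open>k\<close>-th power of the cycle moves each entry of \<open>cs\<close> by \<open>k\<close> places around the list.
\<close>
lemma orbit_cycle_of_list: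
  assumes "distinct cs" "x \<in> set cs"
  shows "Orbits.orbit (cycle_of_list cs) x = set cs"
proof -
  let ?f = "cycle_of_list cs" and ?n = "length cs"
  obtain i where i: "i < ?n" "x = cs ! i" using assms(2) by (auto simp: in_set_conv_nth)
  have pow: "(?f ^^ k) x = cs ! ((k + i) mod ?n)" for k
  proof -
    have "(?f ^^ k) x = map (?f ^^ k) cs ! i" using i by simp
    also have "\<dots> = rotate k cs ! i" by (simp only: cyclic_rotation[OF assms(1)])
    finally show ?thesis using i by (simp add: nth_rotate)
  qed
  have "Orbits.orbit ?f x = {(?f ^^ k) x | k. True}"
    by (rule orbit_altdef_permutation[OF permutation_of_cycle])
  also have "\<dots> = set cs"
  proof
    show "{(?f ^^ k) x | k. True} \<subseteq> set cs"
      using i(1) by (auto simp: pow intro!: nth_mem mod_less_divisor)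
    show "set cs \<subseteq> {(?f ^^ k) x | k. True}"
    proof
      fix y assume "y \<in> set cs"
      then obtain j where j: "j < ?n" "y = cs ! j" by (auto simp: in_set_conv_nth)
      have "(j + (?n - i) + i) mod ?n = j" using i j by simp
      then have "(?f ^^ (j + (?n - i))) x = y" by (simp add: pow j)
      then show "y \<in> {(?f ^^ k) x | k. True}" by blast
    qed
  qed
  finally show ?thesis .
qed

lemma sign_cycle_of_list:
  "distinct cs \<Longrightarrow> cs \<noteq> [] \<Longrightarrow> sign (cycle_of_list cs) = (- 1) ^ (length cs + 1)"
proof (induction cs rule: cycle_of_list.induct)
  case (1 i j cs)
  then have "sign (cycle_of_list (i # j # cs)) = sign (transpose i j) * sign (cycle_of_list (j # cs))"
    unfolding cycle_of_list.simps(1) by (intro sign_compose permutation_swap_id permutation_of_cycle)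
  then show ?case using 1 by (simp add: sign_swap_id del: cycle_of_list.simps)
qed simp_all

text \<open>
  Multiplying \<open>p\<close> by a cycle disjoint from it adds one orbit and keeps the others. This is the step
  both for computing the sign of a permutation and for building one with a given cycle type.
\<close>
lemma orbits_cycle_comp:
  assumes p: "p permutes S" and cs: "distinct cs" "set cs \<inter> S = {}" "cs \<noteq> []"
  shows "Orbits.orbit (cycle_of_list cs \<circ> p) ` (set cs \<union> S) = insert (set cs) (Orbits.orbit p ` S)"
    and "set cs \<notin> Orbits.orbit p ` S"
proof -
  let ?f = "cycle_of_list cs \<circ> p"
  have 1: "Orbits.orbit ?f x = set cs" if "x \<in> set cs" for x
  proof -
    have "Orbits.orbit (cycle_of_list cs) x = Orbits.orbit ?f x"
    proof (rule orbit_cong0[OF that])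
      show "cycle_of_list cs \<in> set cs \<rightarrow> set cs"
        using cycle_permutes[of cs] by (auto simp: permutes_in_image)
      show "cycle_of_list cs y = ?f y" if "y \<in> set cs" for y
      proof -
        have "y \<notin> S" using cs(2) that by blast
        then show ?thesis using permutes_not_in[OF p, of y] by simp
      qed
    qed
    then show ?thesis using orbit_cycle_of_list[OF cs(1) that] by simp
  qed
  have 2: "Orbits.orbit ?f x = Orbits.orbit p x" if "x \<in> S" for x
  proof -
    have "Orbits.orbit p x = Orbits.orbit ?f x"
    proof (rule orbit_cong0[OF that])
      show "p \<in> S \<rightarrow> S" using p by (auto simp: permutes_in_image)
      show "p y = ?f y" if "y \<in> S" for y
      proof -
        have "p y \<in> S" using p that by (simp add: permutes_in_image)
        then have "p y \<notin> set cs" using cs(2) by blast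
        then show ?thesis by (simp add: id_outside_supp)
      qed
    qed
    then show ?thesis by simp
  qed
  have "Orbits.orbit ?f ` set cs = (\<lambda>_. set cs) ` set cs" by (rule image_cong[OF refl 1])
  then have "Orbits.orbit ?f ` set cs = {set cs}" using cs(3) by (simp add: image_constant_conv)
  moreover have "Orbits.orbit ?f ` S = Orbits.orbit p ` S" using 2 by (rule image_cong[OF refl])
  ultimately show "Orbits.orbit ?f ` (set cs \<union> S) = insert (set cs) (Orbits.orbit p ` S)"
    by (simp add: image_Un)
  show "set cs \<notin> Orbits.orbit p ` S"
  proof
    assume "set cs \<in> Orbits.orbit p ` S"
    then have "set cs \<subseteq> S" using permutes_orbit_subset[OF p] by auto
    then show False using cs(2,3) by (metis Int_absorb2 set_empty)
  qed
qed

lemma cycle_decomp_permutes: "cycle_decomp S p \<Longrightarrow> p permutes S \<and> finite S"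
proof (induction rule: cycle_decomp.induct)
  case (comp I p cs)
  then show ?case
    using permutes_compose[of p "set cs \<union> I" "cycle_of_list cs"] cycle_permutes[of cs]
    by (meson List.finite_set finite_UnI permutes_subset sup_ge1 sup_ge2)
qed (rule conjI[OF permutes_id finite.emptyI])

text \<open>
  By decomposition into disjoint cycles: a cycle on \<open>k\<close> points has sign \<open>(- 1)\<^sup>k\<^sup>+\<^sup>1\<close> and
  contributes \<open>k\<close> points and one orbit. The exponent is a sum instead of a difference since only its
  parity matters.
\<close>
lemma sign_eq_orbits:
  assumes "p permutes S" "finite S"
  shows "sign p = (- 1) ^ (card S + card (Orbits.orbit p ` S))"
proof -
  have "cycle_decomp S p" by (rule cycle_decomposition[OF assms])
  then show ?thesis
  proof (induction rule: cycle_decomp.induct)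
    case (comp I p cs)
    have p: "p permutes I" and fin: "finite I" using cycle_decomp_permutes[OF comp.hyps(1)] by auto
    show ?case
    proof (cases "cs = []")
      case False
      note orb = orbits_cycle_comp[OF p comp.hyps(2,3) False]
      have "sign (cycle_of_list cs \<circ> p) = sign (cycle_of_list cs) * sign p"
        using p fin by (intro sign_compose permutation_of_cycle) (auto simp: permutation_permutes)
      also have "\<dots> = (- 1) ^ (length cs + 1) * (- 1) ^ (card I + card (Orbits.orbit p ` I))"
        using comp.IH sign_cycle_of_list[OF comp.hyps(2) False] by simp
      also have "\<dots> = (- 1) ^ (card (set cs \<union> I) + card (Orbits.orbit (cycle_of_list cs \<circ> p) ` (set cs \<union> I)))"
        unfolding orb(1) using orb(2) fin comp.hyps(2,3)
        by (simp add: card_Un_disjoint distinct_card power_add)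
      finally show ?thesis .
    qed (use comp in simp)
  qed simp
qed

lemma exists_cycle_type:
  assumes "finite S" "card S = sum_list l" "0 \<notin> set l"
  shows "\<exists>p. p permutes S \<and> image_mset card (mset_set (Orbits.orbit p ` S)) = mset l"
  using assms
proof (induction l arbitrary: S)
  case Nil
  then show ?case by (auto intro!: exI[of _ id] permutes_id)
next
  case (Cons a l)
  obtain T where T: "T \<subseteq> S" "card T = a" "finite T"
    using obtain_subset_with_card_n[of a S] Cons.prems by auto
  obtain cs where cs: "set cs = T" "distinct cs" using finite_distinct_list[OF T(3)] by blast
  have ne: "cs \<noteq> []" using cs T(2) Cons.prems(3) by auto
  have "card (S - T) = sum_list l" using T Cons.prems by (simp add: card_Diff_subset)
  then obtain p where p: "p permutes (S - T)"
    and ct: "image_mset card (mset_set (Orbits.orbit p ` (S - T))) = mset l"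
    using Cons.IH[of "S - T"] Cons.prems by auto
  have disj: "set cs \<inter> (S - T) = {}" and un: "set cs \<union> (S - T) = S" using cs T by auto
  note orb = orbits_cycle_comp[OF p cs(2) disj ne, unfolded un]
  have "cycle_of_list cs \<circ> p permutes S"
    using p cycle_permutes[of cs] cs(1) T(1)
    by (intro permutes_compose) (auto intro: permutes_subset)
  moreover have "image_mset card (mset_set (Orbits.orbit (cycle_of_list cs \<circ> p) ` S)) = mset (a # l)"
    unfolding orb(1) using orb(2) ct Cons.prems(1) T(2) cs(1) by simp
  ultimately show ?case by blast
qed

text \<open>
  The class is nonempty by \<open>exists_cycle_type\<close>, so the common value of the sign is attained on it.
\<close>
lemma class_value_sign:
  assumes l: "l \<in> partitions d"
  shows "class_value sign (cycle_class d l) = (- 1) ^ (d + length l)"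
proof -
  have val: "sign p = (- 1) ^ (d + length l)" if p: "p \<in> cycle_class d l" for p
  proof -
    have p': "p permutes {1..d}" and ct: "cycle_type d p = mset l"
      using p by (auto simp: cycle_class_def sym_group_carrier)
    have "card (Orbits.orbit p ` {1..d}) = length l"
      using arg_cong[OF ct, of size] by (simp add: cycle_type_def)
    then show ?thesis using sign_eq_orbits[OF p'] by simp
  qed
  obtain p where "p permutes {1..d}" "image_mset card (mset_set (Orbits.orbit p ` {1..d})) = mset l"
    using exists_cycle_type[of "{1..d}" l] l by (auto simp: partitions_def)
  then have "p \<in> cycle_class d l"
    by (simp add: cycle_class_def sym_group_carrier cycle_type_def)
  then have "sign ` cycle_class d l = {(- 1) ^ (d + length l)}"
    using val by (auto simp: image_def)
  then show ?thesis by (simp add: class_value_def)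
qed

section \<open>The alternating sum over partitions\<close>

text \<open>
  Partitions of \<open>d\<close> as multisets, in which parts can be split and merged without sorting.
\<close>
definition part_msets :: "nat \<Rightarrow> nat multiset set" where
  "part_msets d = {M. 0 \<notin># M \<and> sum_mset M = d}"

definition distinct_odd :: "nat multiset \<Rightarrow> bool" where
  "distinct_odd M \<longleftrightarrow> (\<forall>x \<in># M. odd x \<and> count M x = 1)"

lemma bij_betw_mset_partitions: "bij_betw mset (partitions d) (part_msets d)"
proof (rule bij_betwI[of _ _ _ "\<lambda>M. rev (sorted_list_of_multiset M)"])
  show "mset \<in> partitions d \<rightarrow> part_msets d"
    by (auto simp: partitions_def part_msets_def sum_mset_sum_list)
  show "(\<lambda>M. rev (sorted_list_of_multiset M)) \<in> part_msets d \<rightarrow> partitions d"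
  proof
    fix M assume M: "M \<in> part_msets d"
    have "sum_list (rev (sorted_list_of_multiset M)) = sum_mset M"
      by (metis mset_rev mset_sorted_list_of_multiset sum_mset_sum_list)
    then show "rev (sorted_list_of_multiset M) \<in> partitions d"
      using M by (simp add: partitions_def part_msets_def sorted_wrt_rev sorted_sorted_list_of_multiset)
  qed
  fix l assume "l \<in> partitions d"
  then have "sorted (rev l)" by (simp add: partitions_def sorted_wrt_rev)
  then have "sorted_list_of_multiset (mset l) = rev l"
    by (metis mset_rev sorted_list_of_multiset_mset sorted_sort_id)
  then show "rev (sorted_list_of_multiset (mset l)) = l" by simp
qed simp

lemma finite_part_msets: "finite (part_msets d)"
proof -
  have "length l \<le> sum_list l" if "0 \<notin> set l" for l :: "nat list"
    using that by (induction l) auto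
  then have "partitions d \<subseteq> {l. set l \<subseteq> {..d} \<and> length l \<le> d}"
    by (auto simp: partitions_def member_le_sum_list)
  then have "finite (partitions d)"
    using finite_lists_length_le[of "{..d}" d] finite_subset by blast
  then show ?thesis using bij_betw_finite[OF bij_betw_mset_partitions] by blast
qed

text \<open>
  The pairs \<open>(N, a)\<close> for which the partition \<open>N\<close> with an added part \<open>2a\<close> is to be matched with \<open>N\<close> with
  two added parts \<open>a\<close>. The condition on even parts makes \<open>2a\<close> the largest even part of the former
  partition, and the condition on repeated parts makes \<open>a\<close> the largest repeated part of the latter.
  Thus \<open>a\<close> can be read off from either partition.
\<close>
definition pivot_pairs :: "nat \<Rightarrow> (nat multiset \<times> nat) set" where
  "pivot_pairs d = {(N, a). 0 \<notin># N \<and> 0 < a \<and> sum_mset N + 2 * a = d \<and>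
     (\<forall>x \<in># N. even x \<longrightarrow> x < 2 * a) \<and> (\<forall>x. 2 \<le> count N x \<longrightarrow> x \<le> a)}"

lemma inj_on_merged: "inj_on (\<lambda>(N, a). add_mset (2 * a) N) (pivot_pairs d)"
proof (rule inj_onI, clarify)
  fix N a N' a'
  assume P: "(N, a) \<in> pivot_pairs d" "(N', a') \<in> pivot_pairs d" and eq: "add_mset (2 * a) N = add_mset (2 * a') N'"
  have "\<not> b < c" if "(M, b) \<in> pivot_pairs d" "(M', c) \<in> pivot_pairs d"
    "add_mset (2 * b) M = add_mset (2 * c) M'" for b c M M'
  proof
    assume "b < c"
    have "2 * c \<in># add_mset (2 * b) M" unfolding that(3) by simp
    then have "2 * c \<in># M" using \<open>b < c\<close> by auto
    then show False using that(1) \<open>b < c\<close> by (auto simp: pivot_pairs_def)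
  qed
  from this[OF P eq] this[OF P(2,1) eq[symmetric]] have "a = a'" by simp
  with eq show "N = N' \<and> a = a'" by simp
qed

lemma inj_on_split: "inj_on (\<lambda>(N, a). add_mset a (add_mset a N)) (pivot_pairs d)"
proof (rule inj_onI, clarify)
  fix N a N' a'
  assume P: "(N, a) \<in> pivot_pairs d" "(N', a') \<in> pivot_pairs d"
    and eq: "add_mset a (add_mset a N) = add_mset a' (add_mset a' N')"
  have "\<not> b < c" if "(M, b) \<in> pivot_pairs d" "(M', c) \<in> pivot_pairs d"
    "add_mset b (add_mset b M) = add_mset c (add_mset c M')" for b c M M'
  proof
    assume "b < c"
    then have "2 \<le> count M c" using arg_cong[OF that(3), of "\<lambda>X. count X c"] by simp
    then show False using that(1) \<open>b < c\<close> by (auto simp: pivot_pairs_def)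
  qed
  from this[OF P eq] this[OF P(2,1) eq[symmetric]] have "a = a'" by simp
  with eq show "N = N' \<and> a = a'" by simp
qed

text \<open>
  A partition of both forms would have the largest even part \<open>2a\<close>, not less than twice any repeated
  part, and the largest repeated part \<open>b\<close>, more than half of any even part.
\<close>
lemma merged_split_disjoint:
  "(\<lambda>(N, a). add_mset (2 * a) N) ` pivot_pairs d \<inter> (\<lambda>(N, a). add_mset a (add_mset a N)) ` pivot_pairs d = {}"
proof -
  have False if P: "(N, a) \<in> pivot_pairs d" "(N', b) \<in> pivot_pairs d"
    and eq: "add_mset (2 * a) N = add_mset b (add_mset b N')" for N a N' b
  proof -
    have "2 \<le> count (add_mset (2 * a) N) b" unfolding eq by simp
    moreover have "2 * a \<notin># N" using P(1) by (auto simp: pivot_pairs_def)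
    ultimately have "b \<noteq> 2 * a" "2 \<le> count N b" by (auto simp: not_in_iff split: if_splits)
    then have "b \<le> a" using P(1) by (auto simp: pivot_pairs_def)
    have "2 * a \<in># add_mset b (add_mset b N')" unfolding eq[symmetric] by simp
    then have "2 * a \<in># N'" using \<open>b \<noteq> 2 * a\<close> by auto
    then have "2 * a < 2 * b" using P(2) by (auto simp: pivot_pairs_def)
    then show False using \<open>b \<le> a\<close> by simp
  qed
  then show ?thesis by (auto simp: set_eq_iff)
qed

text \<open>
  Let \<open>e\<close> be the largest even part and \<open>r\<close> the largest repeated part, \<open>0\<close> if there is none. If
  \<open>2r \<le> e\<close>, the part \<open>e\<close> is the one to be split; otherwise two copies of \<open>r\<close> are the ones to be merged.
\<close>
lemma not_distinct_odd_eq: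
  "{M \<in> part_msets d. \<not> distinct_odd M} =
    (\<lambda>(N, a). add_mset (2 * a) N) ` pivot_pairs d \<union> (\<lambda>(N, a). add_mset a (add_mset a N)) ` pivot_pairs d"
    (is "?L = ?A \<union> ?B")
proof
  show "?A \<union> ?B \<subseteq> ?L"
    by (auto simp: pivot_pairs_def part_msets_def distinct_odd_def)
  show "?L \<subseteq> ?A \<union> ?B"
  proof
    fix M assume "M \<in> ?L"
    then have M0: "0 \<notin># M" and Md: "sum_mset M = d" and nd: "\<not> distinct_odd M"
      by (auto simp: part_msets_def)
    define E where "E = insert 0 {x \<in> set_mset M. even x}"
    define R where "R = insert 0 {x \<in> set_mset M. 2 \<le> count M x}"
    define e where "e = Max E"
    define r where "r = Max R"
    have finE: "finite E" and finR: "finite R" by (auto simp: E_def R_def)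
    have e_in: "e \<in> E" and r_in: "r \<in> R"
      unfolding e_def r_def using Max_in[OF finE] Max_in[OF finR] by (simp_all add: E_def R_def)
    have e_max: "x \<le> e" if "x \<in># M" "even x" for x
      unfolding e_def using finE that by (intro Max_ge) (auto simp: E_def)
    have r_max: "x \<le> r" if "2 \<le> count M x" for x
      unfolding r_def using finR that by (intro Max_ge) (auto simp: R_def intro!: count_inI)
    have pos: "0 < e \<or> 0 < r"
    proof (rule ccontr)
      assume 0: "\<not> ?thesis"
      have "odd x \<and> count M x = 1" if x: "x \<in># M" for x
      proof
        have "x \<noteq> 0" using M0 x by metis
        then show "odd x" using e_max[OF x] 0 by auto
        have "\<not> 2 \<le> count M x" using r_max[of x] 0 \<open>x \<noteq> 0\<close> by auto
        moreover have "count M x \<noteq> 0" using x by simp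
        ultimately show "count M x = 1" by linarith
      qed
      then show False using nd by (auto simp: distinct_odd_def)
    qed
    show "M \<in> ?A \<union> ?B"
    proof (cases "2 * r \<le> e")
      case True
      then have "0 < e" using pos by auto
      then have e: "e \<in># M" "even e" using e_in by (auto simp: E_def)
      then obtain a where a: "e = 2 * a" by (auto elim: evenE)
      define N where "N = M - {#e#}"
      have MN: "M = add_mset (2 * a) N" using e a by (simp add: N_def)
      have "(N, a) \<in> pivot_pairs d" unfolding pivot_pairs_def
      proof (clarsimp, intro conjI ballI allI impI)
        show "0 \<notin># N" using M0 MN by auto
        show "0 < a" using \<open>0 < e\<close> a by simp
        show "sum_mset N + 2 * a = d" using Md MN by simp
        fix x
        show "x < 2 * a" if "x \<in># N" "even x"
        proof -
          have "x \<le> 2 * a" using e_max[of x] that MN a by simp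
          moreover have "x \<noteq> 2 * a"
          proof
            assume "x = 2 * a"
            then have "2 \<le> count M e" using that(1) MN a by (simp add: Suc_le_eq)
            then show False using r_max[of e] True \<open>0 < e\<close> by simp
          qed
          ultimately show ?thesis by simp
        qed
        show "x \<le> a" if "2 \<le> count N x"
        proof -
          have "count N x \<le> count M x" by (simp add: N_def)
          then have "2 \<le> count M x" using that by linarith
          then show ?thesis using r_max[of x] True a by simp
        qed
      qed
      then show ?thesis using MN by force
    next
      case False
      then have "0 < r" by simp
      then have r: "2 \<le> count M r" using r_in by (auto simp: R_def)
      define N where "N = M - {#r, r#}"
      have MN: "M = add_mset r (add_mset r N)"
        using r by (intro multiset_eqI) (auto simp: N_def)
      have "(N, r) \<in> pivot_pairs d" unfolding pivot_pairs_def
      proof (clarsimp, intro conjI ballI allI impI)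
        show "0 \<notin># N" using M0 MN by auto
        show "0 < r" by fact
        show "sum_mset N + 2 * r = d" using Md MN by simp
        fix x
        show "x < 2 * r" if "x \<in># N" "even x" using e_max[of x] that MN False by simp
        show "x \<le> r" if "2 \<le> count N x"
        proof -
          have "count N x \<le> count M x" by (simp add: N_def)
          then have "2 \<le> count M x" using that by linarith
          then show ?thesis by (rule r_max)
        qed
      qed
      then show ?thesis using MN by force
    qed
  qed
qed

text \<open>
  The two partitions built from a pair \<open>(N, a)\<close> differ by one in their number of parts, hence cancel.
  A sum of odd parts has the parity of the number of parts, so each remaining term is \<open>1\<close>.
\<close>
lemma alternating_partition_sum:
  "(\<Sum>l\<in>partitions d. (- 1) ^ (d + length l)) = int (card {M \<in> part_msets d. distinct_odd M})"
proof -
  let ?s = "\<lambda>M. (- 1 :: int) ^ (d + size M)"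
  let ?A = "\<lambda>(N, a). add_mset (2 * a) N" and ?B = "\<lambda>(N, a). add_mset a (add_mset a N)"
  have fin: "finite (part_msets d)" by (rule finite_part_msets)
  have finAB: "finite (?A ` pivot_pairs d)" "finite (?B ` pivot_pairs d)"
  proof -
    have "finite {M \<in> part_msets d. \<not> distinct_odd M}" using fin by simp
    then show "finite (?A ` pivot_pairs d)" "finite (?B ` pivot_pairs d)"
      unfolding not_distinct_odd_eq by (simp_all only: finite_Un)
  qed
  have "(\<Sum>l\<in>partitions d. (- 1) ^ (d + length l)) = (\<Sum>M\<in>part_msets d. ?s M)"
    using sum.reindex_bij_betw[OF bij_betw_mset_partitions, of ?s] by simp
  also have "\<dots> = (\<Sum>M\<in>{M \<in> part_msets d. distinct_odd M}. ?s M) + (\<Sum>M\<in>{M \<in> part_msets d. \<not> distinct_odd M}. ?s M)"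
    using fin by (subst sum.union_disjoint[symmetric]) (auto intro!: sum.cong)
  also have "(\<Sum>M\<in>{M \<in> part_msets d. \<not> distinct_odd M}. ?s M) =
      (\<Sum>M\<in>?A ` pivot_pairs d. ?s M) + (\<Sum>M\<in>?B ` pivot_pairs d. ?s M)"
    unfolding not_distinct_odd_eq using finAB merged_split_disjoint by (rule sum.union_disjoint)
  also have "\<dots> = (\<Sum>P\<in>pivot_pairs d. ?s (?A P) + ?s (?B P))"
    by (simp add: sum.reindex[OF inj_on_merged] sum.reindex[OF inj_on_split] sum.distrib)
  also have "\<dots> = 0" by (intro sum.neutral) auto
  also have "(\<Sum>M\<in>{M \<in> part_msets d. distinct_odd M}. ?s M) = (\<Sum>M\<in>{M \<in> part_msets d. distinct_odd M}. 1)"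
  proof (intro sum.cong refl)
    fix M assume M: "M \<in> {M \<in> part_msets d. distinct_odd M}"
    then have "\<forall>x \<in># M. odd x" by (auto simp: distinct_odd_def)
    then have "even (sum_mset M + size M)" by (induction M) auto
    then show "?s M = 1" using M by (simp add: part_msets_def)
  qed
  finally show ?thesis by simp
qed

section \<open>Symmetric diagrams and their diagonal hooks\<close>

definition lower_set :: "(nat \<times> nat) set \<Rightarrow> bool" where
  "lower_set D \<longleftrightarrow> (\<forall>i j i' j'. (i, j) \<in> D \<longrightarrow> i' \<le> i \<longrightarrow> j' \<le> j \<longrightarrow> (i', j') \<in> D)"

lemma lower_setD: "lower_set D \<Longrightarrow> (i, j) \<in> D \<Longrightarrow> i' \<le> i \<Longrightarrow> j' \<le> j \<Longrightarrow> (i', j') \<in> D"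
  unfolding lower_set_def by blast

lemma initial_segment_eq_lessThan:
  fixes A :: "nat set"
  assumes "finite A" "\<And>i j. i \<in> A \<Longrightarrow> j \<le> i \<Longrightarrow> j \<in> A"
  shows "A = {..<card A}"
proof -
  define m where "m = (LEAST m. m \<notin> A)"
  have ex: "\<exists>m. m \<notin> A" using assms(1) by (metis infinite_UNIV_nat UNIV_eq_I)
  have "m \<notin> A" unfolding m_def using ex by (rule LeastI_ex)
  moreover have "j \<in> A" if "j < m" for j using not_less_Least that unfolding m_def by blast
  ultimately have "A = {..<m}" using assms(2) by (auto simp: not_less[symmetric])
  then show ?thesis by simp
qed

lemma card_young_diagram: "card (young_diagram l) = sum_list l" "finite (young_diagram l)"
proof -
  have eq: "young_diagram l = (SIGMA i:{..<length l}. {..<l ! i})"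
    by (auto simp: young_diagram_def)
  show "finite (young_diagram l)" unfolding eq by simp
  show "card (young_diagram l) = sum_list l"
    unfolding eq by (simp add: sum_list_sum_nth lessThan_atLeast0)
qed

text \<open>
  Rows and columns of a finite lower set are initial segments of the natural numbers, and the row
  lengths form the partition.
\<close>
lemma young_diagrams_eq_lower_sets:
  "young_diagram ` partitions d = {D. finite D \<and> lower_set D \<and> card D = d}"
proof (intro equalityI subsetI)
  fix D assume "D \<in> young_diagram ` partitions d"
  then obtain l where l: "l \<in> partitions d" "D = young_diagram l" by blast
  have "l ! i \<le> l ! i'" if "i' \<le> i" "i < length l" for i i'
    using l(1) that sorted_wrt_nth_less[of "(\<ge>)" l i' i] by (cases "i' = i") (auto simp: partitions_def)
  then have "lower_set D" unfolding lower_set_def l(2) young_diagram_def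
    by (auto intro: order.strict_trans2 dest: le_less_trans)
  then show "D \<in> {D. finite D \<and> lower_set D \<and> card D = d}"
    using l by (simp add: card_young_diagram partitions_def)
next
  fix D assume "D \<in> {D. finite D \<and> lower_set D \<and> card D = d}"
  then have fin: "finite D" and low: "lower_set D" and card: "card D = d" by auto
  define r where "r i = card {j. (i, j) \<in> D}" for i
  define k where "k = card {i. (i, 0) \<in> D}"
  have fin_row: "finite {j. (i, j) \<in> D}" for i
    by (rule finite_subset[of _ "snd ` D"]) (force simp: fin)+
  have fin_col: "finite {i. (i, 0) \<in> D}"
    by (rule finite_subset[of _ "fst ` D"]) (force simp: fin)+
  have row: "{j. (i, j) \<in> D} = {..<r i}" for i
    unfolding r_def by (rule initial_segment_eq_lessThan[OF fin_row]) (auto intro: lower_setD[OF low])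
  have col: "{i. (i, 0) \<in> D} = {..<k}"
    unfolding k_def by (rule initial_segment_eq_lessThan[OF fin_col]) (auto intro: lower_setD[OF low])
  define l where "l = map r [0..<k]"
  have D_eq: "D = young_diagram l"
  proof -
    have "(i, j) \<in> D \<longleftrightarrow> i < k \<and> j < r i" for i j
      using row[of i] col lower_setD[OF low, of i j i 0] by auto
    then show ?thesis by (auto simp: young_diagram_def l_def)
  qed
  have "r i' \<le> r i" if "i \<le> i'" for i i'
    unfolding r_def by (rule card_mono[OF fin_row]) (auto intro: lower_setD[OF low] that)
  then have "sorted_wrt (\<ge>) l" by (auto simp: l_def sorted_wrt_map sorted_wrt_upt intro!: sorted_wrt_mono_rel[OF _ sorted_wrt_upt])
  moreover have "0 \<notin> set l"
  proof
    assume "0 \<in> set l"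
    then obtain i where "i < k" "r i = 0" by (auto simp: l_def)
    then show False using row[of i] col by auto
  qed
  ultimately have "l \<in> partitions d"
    using card card_young_diagram(1)[of l] by (simp add: partitions_def D_eq)
  then show "D \<in> young_diagram ` partitions d" using D_eq by blast
qed

text \<open>
  The diagram whose diagonal hooks have the sizes given by the list: a corner with arm and leg of
  length \<open>h div 2\<close> (for odd \<open>h\<close> it has \<open>h\<close> cells), and the rest shifted by one along the diagonal.
\<close>
fun hook_diagram :: "nat list \<Rightarrow> (nat \<times> nat) set" where
  "hook_diagram [] = {}"
| "hook_diagram (h # hs) = {(i, j). i = 0 \<and> j \<le> h div 2 \<or> j = 0 \<and> i \<le> h div 2} \<union>
     map_prod Suc Suc ` hook_diagram hs"

definition distinct_odd_lists :: "nat list set" where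
  "distinct_odd_lists = {l. sorted_wrt (>) l \<and> (\<forall>x \<in> set l. odd x)}"

lemma mem_hook_diagram_Cons [simp]:
  "(0, j) \<in> hook_diagram (h # hs) \<longleftrightarrow> j \<le> h div 2"
  "(i, 0) \<in> hook_diagram (h # hs) \<longleftrightarrow> i \<le> h div 2"
  "(Suc i, Suc j) \<in> hook_diagram (h # hs) \<longleftrightarrow> (i, j) \<in> hook_diagram hs"
  by auto

lemma swap_image_eq_iff: "prod.swap ` D = D \<longleftrightarrow> (\<forall>i j. (i, j) \<in> D \<longleftrightarrow> (j, i) \<in> D)"
proof -
  have "prod.swap ` D = {(i, j). (j, i) \<in> D}" by force
  then show ?thesis by auto
qed

text \<open>
  The result is a lower set because the shifted diagram has a first row of length
  \<open>h' div 2 + 1\<close>, where \<open>h'\<close> is the next hook size, and \<open>h' < h\<close> with both odd gives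
  \<open>h' div 2 + 1 \<le> h div 2\<close>, so it does not stick out below the arm of the first hook.
\<close>
lemma hook_diagram_properties:
  assumes "l \<in> distinct_odd_lists"
  shows "finite (hook_diagram l)" "card (hook_diagram l) = sum_list l"
    "prod.swap ` hook_diagram l = hook_diagram l" "lower_set (hook_diagram l)"
proof -
  have "finite (hook_diagram l) \<and> card (hook_diagram l) = sum_list l \<and>
    (\<forall>i j. (i, j) \<in> hook_diagram l \<longleftrightarrow> (j, i) \<in> hook_diagram l) \<and> lower_set (hook_diagram l)"
    using assms
  proof (induction l)
    case Nil
    then show ?case by (simp add: lower_set_def)
  next
    case (Cons h hs)
    have hs: "hs \<in> distinct_odd_lists" and "odd h" and gt: "\<And>x. x \<in> set hs \<Longrightarrow> x < h \<and> odd x"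
      using Cons.prems by (auto simp: distinct_odd_lists_def)
    from Cons.IH[OF hs] have IH: "finite (hook_diagram hs)" "card (hook_diagram hs) = sum_list hs"
      "\<And>i j. (i, j) \<in> hook_diagram hs \<longleftrightarrow> (j, i) \<in> hook_diagram hs" "lower_set (hook_diagram hs)" by auto
    let ?m = "h div 2"
    let ?H = "{(i, j). i = 0 \<and> j \<le> ?m \<or> j = 0 \<and> i \<le> ?m}"
    have H: "?H = Pair 0 ` {..?m} \<union> (\<lambda>i. (i, 0)) ` {1..?m}"
      by (auto simp: image_iff)
    have finH: "finite ?H" unfolding H by simp
    have "card ?H = card (Pair (0::nat) ` {..?m}) + card ((\<lambda>i. (i, 0::nat)) ` {1..?m})"
      unfolding H by (rule card_Un_disjoint) auto
    also have "\<dots> = h" using \<open>odd h\<close> by (simp add: card_image inj_on_def) presburger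
    finally have cardH: "card ?H = h" .
    have fin: "finite (hook_diagram (h # hs))" using finH IH(1) by simp
    have "card (hook_diagram (h # hs)) = card ?H + card (map_prod Suc Suc ` hook_diagram hs)"
      unfolding hook_diagram.simps using finH IH(1) by (intro card_Un_disjoint) auto
    also have "card (map_prod Suc Suc ` hook_diagram hs) = sum_list hs"
      using IH(2) by (subst card_image) (auto simp: inj_on_def)
    finally have card: "card (hook_diagram (h # hs)) = sum_list (h # hs)" by (simp add: cardH)
    have sym: "(i, j) \<in> hook_diagram (h # hs) \<longleftrightarrow> (j, i) \<in> hook_diagram (h # hs)" for i j
      by (cases i; cases j) (simp_all add: IH(3) del: hook_diagram.simps)
    \<comment> \<open>The first row is at least as long as any other.\<close>
    have row0: "(0, j') \<in> hook_diagram (h # hs)" if "(i, j) \<in> hook_diagram (h # hs)" "j' \<le> j" for i j j'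
    proof (cases "i = 0 \<or> j = 0")
      case True
      then show ?thesis using that by (cases i; cases j) (auto simp del: hook_diagram.simps)
    next
      case False
      then obtain x y where xy: "i = Suc x" "j = Suc y" by (metis not0_implies_Suc)
      then have "(x, y) \<in> hook_diagram hs" using that by (simp del: hook_diagram.simps)
      then have 0: "(0, y) \<in> hook_diagram hs" using lower_setD[OF IH(4)] by blast
      then obtain h' hs' where hs': "hs = h' # hs'" by (cases hs) auto
      then have "y \<le> h' div 2" using 0 by (simp del: hook_diagram.simps)
      moreover have "h' < h" "odd h'" using gt[of h'] hs' by auto
      ultimately have "Suc y \<le> ?m" using \<open>odd h\<close> by presburger
      then show ?thesis using that(2) xy by (simp del: hook_diagram.simps)
    qed
    have "lower_set (hook_diagram (h # hs))" unfolding lower_set_def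
    proof (intro allI impI)
      fix i j i' j' assume D: "(i, j) \<in> hook_diagram (h # hs)" and le: "i' \<le> i" "j' \<le> j"
      show "(i', j') \<in> hook_diagram (h # hs)"
      proof (cases "i' = 0 \<or> j' = 0")
        case True
        then show ?thesis using row0[OF D le(2)] row0[of j i, OF _ le(1)] sym D by blast
      next
        case False
        then obtain x y x' y' where "i = Suc x" "j = Suc y" "i' = Suc x'" "j' = Suc y'"
          using le by (metis not0_implies_Suc le_zero_eq)
        then show ?thesis using D le lower_setD[OF IH(4), of x y x' y'] by (simp del: hook_diagram.simps)
      qed
    qed
    with fin card sym show ?case by blast
  qed
  then show "finite (hook_diagram l)" "card (hook_diagram l) = sum_list l"
    "lower_set (hook_diagram l)" "prod.swap ` hook_diagram l = hook_diagram l"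
    by (simp_all add: swap_image_eq_iff)
qed

lemma inj_on_hook_diagram: "inj_on hook_diagram distinct_odd_lists"
proof -
  have "l = l'" if "l \<in> distinct_odd_lists" "l' \<in> distinct_odd_lists" "hook_diagram l = hook_diagram l'" for l l'
    using that
  proof (induction l arbitrary: l')
    case Nil
    have "hook_diagram (h # hs) \<noteq> {}" for h hs
      using mem_hook_diagram_Cons(1)[of 0 h hs] by blast
    with Nil show ?case by (cases l') (auto simp del: hook_diagram.simps(2))
  next
    case (Cons h hs)
    note eq = Cons.prems(3)
    obtain h' hs' where l': "l' = h' # hs'"
      using eq mem_hook_diagram_Cons(1)[of 0 h hs] by (cases l') auto
    have "j \<le> h div 2 \<longleftrightarrow> j \<le> h' div 2" for j
      using mem_hook_diagram_Cons(1)[of j h hs] unfolding eq l' mem_hook_diagram_Cons by simp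
    then have "h div 2 = h' div 2" by (metis order_antisym order_refl)
    moreover have "odd h" "odd h'" using Cons.prems l' by (auto simp: distinct_odd_lists_def)
    ultimately have "h = h'" by presburger
    have "(i, j) \<in> hook_diagram hs \<longleftrightarrow> (i, j) \<in> hook_diagram hs'" for i j
      using mem_hook_diagram_Cons(3)[of i j h hs] unfolding eq l' mem_hook_diagram_Cons by simp
    then have "hook_diagram hs = hook_diagram hs'" by auto
    then have "hs = hs'"
      using Cons.IH[of hs'] Cons.prems(1,2) l' by (simp add: distinct_odd_lists_def)
    with \<open>h = h'\<close> l' show ?case by simp
  qed
  then show ?thesis by (auto intro: inj_onI)
qed

text \<open>
  Strip off the first row and column, whose union is a hook of odd size by symmetry, and apply
  induction to the remaining diagram moved back by one along the diagonal.
\<close>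
lemma hook_diagram_surj:
  assumes "finite D" "lower_set D" "prod.swap ` D = D"
  shows "\<exists>l \<in> distinct_odd_lists. hook_diagram l = D"
  using assms
proof (induction "card D" arbitrary: D rule: less_induct)
  case less
  have sym: "(i, j) \<in> D \<longleftrightarrow> (j, i) \<in> D" for i j
    using less.prems(3) by (simp add: swap_image_eq_iff)
  note low = lower_setD[OF less.prems(2)]
  show ?case
  proof (cases "D = {}")
    case True
    then show ?thesis by (intro bexI[of _ "[]"]) (auto simp: distinct_odd_lists_def)
  next
    case False
    define A where "A = {j. (0, j) \<in> D}"
    have "finite A" unfolding A_def
      by (rule finite_subset[of _ "snd ` D"]) (force simp: less.prems(1))+
    then have "A = {..<card A}"
      by (rule initial_segment_eq_lessThan) (auto simp: A_def intro: low)
    then have A: "j \<in> A \<longleftrightarrow> j < card A" for j by (metis lessThan_iff)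
    obtain i0 j0 where "(i0, j0) \<in> D" using False by (metis ex_in_conv surj_pair)
    then have "(0, 0) \<in> D" using low by blast
    then have "0 \<in> A" by (simp add: A_def)
    then obtain m where m: "card A = Suc m" using A[of 0] by (auto simp: gr0_conv_Suc)
    have row: "(0, j) \<in> D \<longleftrightarrow> j \<le> m" for j using A[of j] unfolding m by (simp add: A_def less_Suc_eq_le)
    define D' where "D' = {(i, j). (Suc i, Suc j) \<in> D}"
    have img: "map_prod Suc Suc ` D' \<subseteq> D - {(0, 0)}" by (auto simp: D'_def)
    have fin': "finite D'"
      using finite_subset[OF img] less.prems(1) by (auto dest!: finite_imageD simp: inj_on_def)
    have "card D' = card (map_prod Suc Suc ` D')" by (rule card_image[symmetric]) (auto simp: inj_on_def)
    also have "\<dots> \<le> card (D - {(0, 0)})" using less.prems(1) img by (intro card_mono) auto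
    also have "\<dots> < card D" using less.prems(1) \<open>(0, 0) \<in> D\<close> by (intro psubset_card_mono) auto
    finally have "card D' < card D" .
    moreover have "lower_set D'" unfolding lower_set_def D'_def by (auto intro: low)
    moreover have "prod.swap ` D' = D'" using sym by (auto simp: D'_def swap_image_eq_iff)
    ultimately obtain hs where hs: "hs \<in> distinct_odd_lists" "hook_diagram hs = D'"
      using less.hyps[of D'] fin' by blast
    define h where "h = 2 * m + 1"
    have hm: "h div 2 = m" and "odd h" by (simp_all add: h_def)
    have "x < h" if x: "x \<in> set hs" for x
    proof -
      obtain h' hs' where hs': "hs = h' # hs'" using x by (cases hs) auto
      have "(0, h' div 2) \<in> D'" unfolding hs(2)[symmetric] hs' by simp
      then have "(0, Suc (h' div 2)) \<in> D" using low by (auto simp: D'_def)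
      then have "h' < h" by (simp add: row h_def)
      moreover have "x \<le> h'" using hs(1) x hs' by (auto simp: distinct_odd_lists_def)
      ultimately show ?thesis by simp
    qed
    then have "h # hs \<in> distinct_odd_lists" using hs(1) \<open>odd h\<close> by (simp add: distinct_odd_lists_def)
    moreover have "hook_diagram (h # hs) = D"
    proof -
      have "(i, j) \<in> hook_diagram (h # hs) \<longleftrightarrow> (i, j) \<in> D" for i j
        using row[of j] row[of i] sym[of i 0]
        by (cases i; cases j) (simp_all add: hm hs(2) D'_def del: hook_diagram.simps)
      then show ?thesis by (simp only: set_eq_iff split_paired_All) blast
    qed
    ultimately show ?thesis by blast
  qed
qed

lemma card_symmetric_young_diagrams:
  "card (symmetric_young_diagrams d) = card {M \<in> part_msets d. distinct_odd M}"
proof -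
  let ?L = "{l \<in> distinct_odd_lists. sum_list l = d}"
  have "symmetric_young_diagrams d = hook_diagram ` ?L"
    unfolding symmetric_young_diagrams_def young_diagrams_eq_lower_sets
  proof (intro equalityI subsetI)
    fix D assume "D \<in> {D \<in> {D. finite D \<and> lower_set D \<and> card D = d}. prod.swap ` D = D}"
    then show "D \<in> hook_diagram ` ?L"
      using hook_diagram_surj[of D] hook_diagram_properties(2) by fastforce
  next
    fix D assume "D \<in> hook_diagram ` ?L"
    then show "D \<in> {D \<in> {D. finite D \<and> lower_set D \<and> card D = d}. prod.swap ` D = D}"
      by (elim imageE CollectE conjE) (simp add: hook_diagram_properties)
  qed
  moreover have "inj_on hook_diagram ?L"
    using inj_on_hook_diagram by (rule inj_on_subset) auto
  ultimately have "card (symmetric_young_diagrams d) = card ?L" by (simp add: card_image)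
  also have "?L = {l \<in> partitions d. distinct_odd (mset l)}"
  proof -
    have "sorted_wrt (>) l \<longleftrightarrow> sorted_wrt (\<ge>) l \<and> distinct l" for l :: "nat list"
      by (induction l) (auto simp: order.strict_iff_order)
    then show ?thesis
      by (auto simp: distinct_odd_lists_def partitions_def distinct_odd_def distinct_count_atmost_1 count_eq_zero_iff)
  qed
  also have "card \<dots> = card {M \<in> part_msets d. distinct_odd M}"
    by (rule bij_betw_same_card[OF bij_betw_Collect[OF bij_betw_mset_partitions refl]])
  finally show ?thesis .
qed

theorem card_symmetric_eq_sign_sum:
  "int (card (symmetric_young_diagrams d)) = (\<Sum>l \<in> partitions d. class_value sign (cycle_class d l))"
  using alternating_partition_sum[of d] by (simp add: card_symmetric_young_diagrams class_value_sign)

section \<open>Fixed representations and symmetric diagrams\<close>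

theorem corollary34:
  fixes G :: "('a, 'b) monoid_scheme" and \<epsilon> :: "'a \<Rightarrow> int"
  shows
    "(group G \<and> finite (carrier G)
        \<and> (\<forall>r \<in> irreps G. \<forall>g \<in> carrier G. character r g \<in> \<real>)
        \<and> \<epsilon> \<in> hom G sign_img \<and> (\<exists>g \<in> carrier G. \<epsilon> g \<noteq> 1)
      \<longrightarrow> finite {X \<in> Irr G. \<forall>r \<in> X. (twist \<epsilon> r, r) \<in> rep_iso G}
        \<and> int (card {X \<in> Irr G. \<forall>r \<in> X. (twist \<epsilon> r, r) \<in> rep_iso G})
            = (\<Sum>c \<in> conj_classes G. class_value \<epsilon> c))
     \<and> (\<forall>d :: nat. int (card (symmetric_young_diagrams d))
            = (\<Sum>l \<in> partitions d. class_value sign (cycle_class d l)))"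
proof (intro conjI allI impI; (elim conjE)?)
  assume "group G" and fin: "finite (carrier G)" and e: "\<epsilon> \<in> hom G sign_img"
  then interpret group G by simp
  show "finite {X \<in> Irr G. \<forall>r \<in> X. (twist \<epsilon> r, r) \<in> rep_iso G}"
    using finite_Irr[OF fin] by simp
  show "int (card {X \<in> Irr G. \<forall>r \<in> X. (twist \<epsilon> r, r) \<in> rep_iso G}) =
      (\<Sum>c \<in> conj_classes G. class_value \<epsilon> c)"
    by (rule card_twist_fixed[OF e fin])
next
  fix d
  show "int (card (symmetric_young_diagrams d)) =
      (\<Sum>l \<in> partitions d. class_value sign (cycle_class d l))"
    by (rule card_symmetric_eq_sign_sum)
qed

end
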